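(* Let $G=(V,E,\mu)$ be a finite weighted digraph with strictly positive weights $\mu_e$, and put $\lambda_e=\mu_e^{-1}$. Let $r=r(t)>0$ and $s=s(t)>0$ be real functions of a real parameter $t>0$, and for $a,b\in V$ let $\mu_{a,b}(t)\in[0,+\infty]$ be the effective resistance from $a$ to $b$ of the circuit $G$ with parameters $r(t),s(t)$. In each of the following four cases the limit $\mu_{a,b}=\lim_{t\to+\infty}\mu_{a,b}(t)$ exists for all $a,b\in V$ and equals the indicated quantity: 1. If $r(t)\to1$ and $s(t)\to 1$ as $t\to+\infty$: $\mu_{a,b}$ is the effective (Ohm) resistance from $a$ to $b$ of the circuit $G$ with parameters $r=s=1$. 2. If $s(t)\to\infty$ and $s(t)/r(t)\to1$ as $t\to+\infty$: $\mu_{a,b}$ is the length of a shortest directed path from $a$ to $b$, where the length of a path $p$ is $\sum_{e\in p}\mu_e$. 3. If $s(t)\to\infty$ and $s(t)/r(t)\to\infty$ as $t\to+\infty$: $\mu_{a,b}=\lambda_{a,b}^{-1}$, where $\lambda_{a,b}$ is the maximum, over directed paths $p$ from $a$ to $b$, of the width $\min_{e\in p}\lambda_e$. 4. If $s(t)\to1$ and $r(t)\to0$ as $t\to+\infty$: $\mu_{a,b}=\lambda_{a,b}^{-1}$, where $\lambda_{a,b}$ is the maximum value of a flow from $a$ to $b$ in $G$ with edge capacities $\lambda_e$. In all four cases the function $(a,b)\mapsto\mu_{a,b}$ is a quasi-metric on $V$, and in cases 3 and 4 it is a quasi-ultrametric, that is, $\mu_{a,b}\le\max(\mu_{a,c},\mu_{c,b})$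 for all $a,b,c\in V$.
   Context: Circuit. $G=(V,E,\mu)$ is a finite digraph (parallel edges allowed), each directed edge $e$ having a resistance $\mu_e>0$; $r,s>0$ are real parameters common to all edges. A potential vector $x=(x_v)_{v\in V}\in\mathbb{R}^V$ determines: - voltages $y_e=x_{v'}-x_{v''}$ for each directed edge $e=(v',v'')$ (from $v'$ to $v''$); - currents $y_e^*=y_e^r/\mu_e^s$ if $y_e\ge 0$, and $y_e^*=0$ if $y_e\le 0$; - fluxes $x_v^*=\sum_{e \text{ begins at } v}y_e^*-\sum_{e\text{ ends at }v}y_e^*$ for $v\in V$. Solution of a two-pole circuit. For distinct nodes $a,b$ and reals $x_a^0\ge x_b^0$, a solution of $(G,a,b)$ is a potential vector $x$ with $x_a=x_a^0$, $x_b=x_b^0$, and $x_v^*=0$ for all $v\in V\setminus\{a,b\}$. Put $y_{a,b}=x_a^0-x_b^0$ and $y_{a,b}^*=x_a^*=-x_b^*$. A solution exists, and the value $y^*_{a,b}$ is the same for all solutions. Effective resistance. If there is a directed path from $a$ to $b$ in $G$ ($a\ne b$), then $\mu_{a,b}$ is the unique positive real number such that $y_{a,b}^*=y_{a,b}^r/\mu_{a,b}^s$ for all $y_{a,b}\ge 0$. If there is no directed path from $a$ to $b$, then $\mu_{a,b}=+\infty$. If $a=b$, then $\mu_{a,b}=0$. Conventions. In all four cases the indicated quantity is $0$ when $a=b$ and $+\infty$ when there is no directed path from $a$ to $b$. A quasi-metric on $V$ is a function $d:V\times V\to[0,+\infty]$ with $d(a,b)=0$ if and only if $a=b$ and $d(a,b)\le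 d(a,c)+d(c,b)$ for all $a,b,c\in V$ (symmetry is not required); a quasi-ultrametric satisfies in addition $d(a,b)\le\max(d(a,c),d(c,b))$. *)

theory Defs
  imports "HOL-Analysis.Analysis" "Graph_Theory.Shortest_Path"
begin

text \<open>Potential vectors, currents and flows are total functions on the vertex or arc type;
  only their values on \<^term>\<open>verts G\<close> and \<^term>\<open>arcs G\<close> matter.\<close>

definition voltage :: "('a, 'e) pre_digraph \<Rightarrow> ('a \<Rightarrow> real) \<Rightarrow> 'e \<Rightarrow> real" where
  "voltage G x e = x (tail G e) - x (head G e)"

definition current ::
  "('a, 'e) pre_digraph \<Rightarrow> ('e \<Rightarrow> real) \<Rightarrow> real \<Rightarrow> real \<Rightarrow> ('a \<Rightarrow> real) \<Rightarrow> 'e \<Rightarrow> real" where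
  "current G mu r s x e =
     (if voltage G x e \<ge> 0 then voltage G x e powr r / mu e powr s else 0)"

definition net_outflow :: "('a, 'e) pre_digraph \<Rightarrow> ('e \<Rightarrow> real) \<Rightarrow> 'a \<Rightarrow> real" where
  "net_outflow G f v = (\<Sum>e\<in>out_arcs G v. f e) - (\<Sum>e\<in>in_arcs G v. f e)"

definition flux ::
  "('a, 'e) pre_digraph \<Rightarrow> ('e \<Rightarrow> real) \<Rightarrow> real \<Rightarrow> real \<Rightarrow> ('a \<Rightarrow> real) \<Rightarrow> 'a \<Rightarrow> real" where
  "flux G mu r s x v = net_outflow G (current G mu r s x) v"

definition two_pole_solution ::
  "('a, 'e) pre_digraph \<Rightarrow> ('e \<Rightarrow> real) \<Rightarrow> real \<Rightarrow> real \<Rightarrow> 'a \<Rightarrow> 'a \<Rightarrow> real \<Rightarrow> real \<Rightarrow>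
     ('a \<Rightarrow> real) \<Rightarrow> bool" where
  "two_pole_solution G mu r s a b xa xb x \<longleftrightarrow>
     x a = xa \<and> x b = xb \<and> (\<forall>v \<in> verts G - {a, b}. flux G mu r s x v = 0)"

text \<open>The finite effective resistance is the unique \<open>m > 0\<close> with
  \<open>y\<^sup>*\<^sub>a\<^sub>b = y\<^sub>a\<^sub>b\<^sup>r / m\<^sup>s\<close> for all \<open>y\<^sub>a\<^sub>b \<ge> 0\<close>, where \<open>y\<^sup>*\<^sub>a\<^sub>b\<close> is the flux out of \<open>a\<close>,
  which does not depend on the chosen solution.\<close>

definition is_resistance ::
  "('a, 'e) pre_digraph \<Rightarrow> ('e \<Rightarrow> real) \<Rightarrow> real \<Rightarrow> real \<Rightarrow> 'a \<Rightarrow> 'a \<Rightarrow> real \<Rightarrow> bool" where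
  "is_resistance G mu r s a b m \<longleftrightarrow> m > 0 \<and>
     (\<forall>xa xb x. xa \<ge> xb \<longrightarrow> two_pole_solution G mu r s a b xa xb x \<longrightarrow>
        flux G mu r s x a = (xa - xb) powr r / m powr s)"

definition effective_resistance ::
  "('a, 'e) pre_digraph \<Rightarrow> ('e \<Rightarrow> real) \<Rightarrow> real \<Rightarrow> real \<Rightarrow> 'a \<Rightarrow> 'a \<Rightarrow> ereal" where
  "effective_resistance G mu r s a b =
     (if a = b then 0
      else if \<not> a \<rightarrow>\<^sup>*\<^bsub>G\<^esub> b then \<infinity>
      else ereal (THE m. is_resistance G mu r s a b m))"

text \<open>\<open>max_width\<close> and \<open>max_flow\<close> are only meaningful for distinct \<open>a\<close> and \<open>b\<close> with \<open>b\<close> reachable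
  from \<open>a\<close>; the remaining cases are settled by convention in \<open>inverse_or_convention\<close>.\<close>

definition max_width ::
  "('a, 'e) pre_digraph \<Rightarrow> ('e \<Rightarrow> real) \<Rightarrow> 'a \<Rightarrow> 'a \<Rightarrow> real" where
  "max_width G lam a b = Max ((\<lambda>p. Min (lam ` set p)) ` {p. pre_digraph.apath G a p b})"

definition is_flow ::
  "('a, 'e) pre_digraph \<Rightarrow> ('e \<Rightarrow> real) \<Rightarrow> 'a \<Rightarrow> 'a \<Rightarrow> ('e \<Rightarrow> real) \<Rightarrow> bool" where
  "is_flow G cap a b f \<longleftrightarrow>
     (\<forall>e \<in> arcs G. 0 \<le> f e \<and> f e \<le> cap e) \<and>
     (\<forall>v \<in> verts G - {a, b}. net_outflow G f v = 0)"

definition max_flow ::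
  "('a, 'e) pre_digraph \<Rightarrow> ('e \<Rightarrow> real) \<Rightarrow> 'a \<Rightarrow> 'a \<Rightarrow> real" where
  "max_flow G cap a b = (GREATEST c. \<exists>f. is_flow G cap a b f \<and> net_outflow G f a = c)"

definition inverse_or_convention ::
  "('a, 'e) pre_digraph \<Rightarrow> ('a \<Rightarrow> 'a \<Rightarrow> real) \<Rightarrow> 'a \<Rightarrow> 'a \<Rightarrow> ereal" where
  "inverse_or_convention G L a b =
     (if a = b then 0
      else if \<not> a \<rightarrow>\<^sup>*\<^bsub>G\<^esub> b then \<infinity>
      else ereal (inverse (L a b)))"

definition quasi_metric_on :: "'a set \<Rightarrow> ('a \<Rightarrow> 'a \<Rightarrow> ereal) \<Rightarrow> bool" where
  "quasi_metric_on V d \<longleftrightarrow>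
     (\<forall>a\<in>V. \<forall>b\<in>V. 0 \<le> d a b) \<and>
     (\<forall>a\<in>V. \<forall>b\<in>V. d a b = 0 \<longleftrightarrow> a = b) \<and>
     (\<forall>a\<in>V. \<forall>b\<in>V. \<forall>c\<in>V. d a b \<le> d a c + d c b)"

definition quasi_ultrametric_on :: "'a set \<Rightarrow> ('a \<Rightarrow> 'a \<Rightarrow> ereal) \<Rightarrow> bool" where
  "quasi_ultrametric_on V d \<longleftrightarrow> quasi_metric_on V d \<and>
     (\<forall>a\<in>V. \<forall>b\<in>V. \<forall>c\<in>V. d a b \<le> max (d a c) (d c b))"

text \<open>The library's distance \<open>\<mu>\<close> is an infimum over all walks. For nonnegative weights it is the
  length of a shortest path (no repeated vertices), and \<open>\<infinity>\<close> if there is no path; for \<open>a = b\<close> the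
  only path is the empty one, of length \<open>0\<close>.\<close>

lemma distance_eq_shortest_path_length:
  fixes G :: "('a, 'e) pre_digraph"
  assumes "fin_digraph G" and nonneg: "\<And>e. e \<in> arcs G \<Longrightarrow> 0 \<le> mu e"
  shows "wf_digraph.\<mu> G mu a b =
    (if a \<rightarrow>\<^sup>*\<^bsub>G\<^esub> b
     then ereal (Min ((\<lambda>p. \<Sum>e\<leftarrow>p. mu e) ` {p. pre_digraph.apath G a p b})) else \<infinity>)"
proof -
  interpret fin_digraph G by fact
  have cost: "awalk_cost mu p = (\<Sum>e\<leftarrow>p. mu e)" for p
    by (induction p) auto
  show ?thesis
  proof (cases "a \<rightarrow>\<^sup>*\<^bsub>G\<^esub> b")
    case False
    then show ?thesis by (simp add: shortest_path_inf)
  next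
    case True
    have "\<not> (\<exists>w c. awalk w c w \<and> w \<in> set (awalk_verts a p) \<and> awalk_cost mu c < 0)" for p
      using pos_cost_pos_awalk_cost[OF _ nonneg] by (meson not_le)
    then obtain p where p: "apath a p b" "\<mu> mu a b = awalk_cost mu p"
      using no_neg_cyc_reach_imp_path[OF True] by blast
    have "Min (awalk_cost mu ` {p. apath a p b}) = awalk_cost mu p"
    proof (rule Min_eqI)
      show "finite (awalk_cost mu ` {p. apath a p b})"
        using apaths_finite by blast
      show "awalk_cost mu p \<in> awalk_cost mu ` {p. apath a p b}"
        using p(1) by blast
      fix c assume "c \<in> awalk_cost mu ` {p. apath a p b}"
      then obtain q where "apath a q b" "c = awalk_cost mu q" by blast
      then show "awalk_cost mu p \<le> c"
        using min_cost_le_walk_cost[of a q b mu] p(2) by (simp add: apath_def)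
    qed
    then show ?thesis using True p(2) by (simp add: cost[abs_def])
  qed
qed

end

theory Submission
  imports Defs
begin

text \<open>
  Let \<open>x\<close> solve the circuit with potentials \<open>1\<close> at \<open>a\<close> and \<open>0\<close> at \<open>b\<close>, and let \<open>C\<close> be its flux, so
  that the resistance is \<open>R = C powr (-1 / s)\<close>. Currents only run downhill, so \<open>C\<close> is the current
  through every level-set cut \<open>{v. c \<le> x v}\<close>.

  Every current is therefore at most \<open>C\<close>, and some path from \<open>a\<close> to \<open>b\<close> carries at least
  \<open>C / N\<close> on each of its arcs, where \<open>N\<close> is the number of arcs. Adding up voltages along paths,
  \<open>R\<close> is up to a factor \<open>N powr (1 / s)\<close> the minimal \<open>\<ell>\<^sub>q\<close> norm of the weights of a path,
  with \<open>q = s / r\<close>; this gives cases 2 (\<open>q \<longlonglongrightarrow> 1\<close>) and 3 (\<open>q \<longlonglongrightarrow> \<infinity>\<close>).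

  In case 4 the currents form a flow with capacities \<open>1 / \<mu> powr s\<close>. Of \<open>n\<close> vertices,
  two consecutive potentials differ by at least \<open>1 / n\<close>, and the cut between them is filled to
  the proportion \<open>n powr (-r) \<longlonglongrightarrow> 1\<close>. This sandwiches \<open>C\<close> between a cut and the maximal flow, and
  also proves that they agree in the limit, which yields the ultrametric inequality.

  Case 1 is continuity of \<open>C\<close> in \<open>(r, s)\<close>, by monotonicity of the current law. The triangle
  inequality for Ohm's law follows by comparing \<open>x\<close> with the solutions for \<open>(a, c)\<close> and \<open>(c, b)\<close>
  which agree with \<open>x\<close> at their poles.
\<close>

section \<open>Flows and cuts\<close>

text \<open>Tychonoff's theorem, indexed by a whole vertex or arc type, which may be infinite. It
  supplies compactness for both flows and potentials.\<close>

lemma compact_box: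
  fixes I :: "'c \<Rightarrow> real set"
  assumes "\<And>i. compact (I i)"
  shows "compact {f. \<forall>i. f i \<in> I i}"
proof -
  have "compactin (product_topology (\<lambda>i. euclidean) UNIV) (PiE UNIV I)"
    using assms by (subst compactin_PiE) auto
  then show ?thesis
    by (simp add: euclidean_product_topology PiE_def Pi_def)
qed

context fin_digraph
begin

text \<open>Summation by parts: an arc counts positively at its tail and negatively at its head.
  Constant weights give conservation, indicators give cuts, and potentials give the dissipated
  power.\<close>

lemma sum_net_outflow:
  "(\<Sum>v\<in>verts G. w v * net_outflow G f v)
     = (\<Sum>e\<in>arcs G. (w (tail G e) - w (head G e)) * f e)"
proof -
  have out: "(\<Sum>v\<in>verts G. \<Sum>e\<in>out_arcs G v. w v * f e) = (\<Sum>e\<in>arcs G. w (tail G e) * f e)"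
    by (subst sum.group[of "arcs G" "verts G" "tail G", symmetric])
      (auto simp: out_arcs_def intro!: sum.cong)
  have into: "(\<Sum>v\<in>verts G. \<Sum>e\<in>in_arcs G v. w v * f e) = (\<Sum>e\<in>arcs G. w (head G e) * f e)"
    by (subst sum.group[of "arcs G" "verts G" "head G", symmetric])
      (auto simp: in_arcs_def intro!: sum.cong)
  show ?thesis
    by (simp add: net_outflow_def right_diff_distrib left_diff_distrib sum_subtractf
        sum_distrib_left out into)
qed

lemma sum_net_outflow_cut:
  assumes "S \<subseteq> verts G"
  shows "(\<Sum>v\<in>S. net_outflow G f v)
     = (\<Sum>e | e \<in> arcs G \<and> tail G e \<in> S \<and> head G e \<notin> S. f e)
       - (\<Sum>e | e \<in> arcs G \<and> tail G e \<notin> S \<and> head G e \<in> S. f e)"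
proof -
  have "(\<Sum>v\<in>S. net_outflow G f v) = (\<Sum>v\<in>verts G. indicator S v * net_outflow G f v)"
    using assms by (intro sum.mono_neutral_cong_left) auto
  also have "\<dots> = (\<Sum>e\<in>arcs G. (indicator S (tail G e) - indicator S (head G e)) * f e)"
    by (rule sum_net_outflow)
  also have "\<dots> = (\<Sum>e\<in>arcs G. (if tail G e \<in> S \<and> head G e \<notin> S then f e else 0)
       - (if tail G e \<notin> S \<and> head G e \<in> S then f e else 0))"
    by (intro sum.cong) auto
  also have "\<dots> = (\<Sum>e | e \<in> arcs G \<and> tail G e \<in> S \<and> head G e \<notin> S. f e)
       - (\<Sum>e | e \<in> arcs G \<and> tail G e \<notin> S \<and> head G e \<in> S. f e)"
    by (simp add: sum_subtractf sum.If_cases Int_def)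
  finally show ?thesis .
qed

definition cut_value :: "('b \<Rightarrow> real) \<Rightarrow> 'a set \<Rightarrow> real" where
  "cut_value f S = (\<Sum>e | e \<in> arcs G \<and> tail G e \<in> S \<and> head G e \<notin> S. f e)"

text \<open>In the sum of net outflows over \<open>S\<close> only \<open>a\<close> survives, since
  \<open>b\<close> lies outside and inner vertices conserve the flow.\<close>

lemma net_outflow_eq_cut:
  assumes "\<And>v. v \<in> verts G - {a, b} \<Longrightarrow> net_outflow G f v = 0"
    and "S \<subseteq> verts G" "a \<in> S" "b \<notin> S"
  shows "net_outflow G f a
    = cut_value f S - (\<Sum>e | e \<in> arcs G \<and> tail G e \<notin> S \<and> head G e \<in> S. f e)"
proof -
  have "(\<Sum>v\<in>S. net_outflow G f v) = (\<Sum>v\<in>{a}. net_outflow G f v)"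
    using assms by (intro sum.mono_neutral_right) (auto intro: finite_subset)
  then show ?thesis
    using sum_net_outflow_cut[OF assms(2)] by (simp add: cut_value_def)
qed

lemma net_outflow_source_sink:
  assumes "\<And>v. v \<in> verts G - {a, b} \<Longrightarrow> net_outflow G f v = 0"
    and "a \<in> verts G" "b \<in> verts G" "a \<noteq> b"
  shows "net_outflow G f b = - net_outflow G f a"
proof -
  have "0 = (\<Sum>v\<in>verts G. net_outflow G f v)"
    using sum_net_outflow[of "\<lambda>_. 1"] by simp
  also have "\<dots> = (\<Sum>v\<in>{a, b}. net_outflow G f v)"
    using assms by (intro sum.mono_neutral_right) auto
  finally show ?thesis using assms by simp
qed

lemma cut_value_mono:
  assumes "\<And>e. e \<in> arcs G \<Longrightarrow> f e \<le> g e"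
  shows "cut_value f S \<le> cut_value g S"
  unfolding cut_value_def using assms by (intro sum_mono) auto

lemma cut_value_cmult: "cut_value (\<lambda>e. k * f e) S = k * cut_value f S"
  by (simp add: cut_value_def sum_distrib_left)

lemma net_outflow_le_cut:
  assumes "\<And>v. v \<in> verts G - {a, b} \<Longrightarrow> net_outflow G f v = 0"
    and "S \<subseteq> verts G" "a \<in> S" "b \<notin> S" and "\<And>e. e \<in> arcs G \<Longrightarrow> 0 \<le> f e"
  shows "net_outflow G f a \<le> cut_value f S"
proof -
  have "0 \<le> (\<Sum>e | e \<in> arcs G \<and> tail G e \<notin> S \<and> head G e \<in> S. f e)"
    using assms(5) by (intro sum_nonneg) auto
  then show ?thesis using net_outflow_eq_cut[OF assms(1-4)] by simp
qed

lemma flow_le_cut: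
  assumes "is_flow G cap a b f" "S \<subseteq> verts G" "a \<in> S" "b \<notin> S"
  shows "net_outflow G f a \<le> cut_value cap S"
proof -
  have "net_outflow G f a \<le> cut_value f S"
    using assms by (intro net_outflow_le_cut[where b=b]) (auto simp: is_flow_def)
  also have "\<dots> \<le> cut_value cap S"
    using assms by (intro cut_value_mono) (auto simp: is_flow_def)
  finally show ?thesis .
qed

lemma continuous_net_outflow:
  assumes "\<And>e. e \<in> arcs G \<Longrightarrow> continuous_on A (\<lambda>x. g x e)"
  shows "continuous_on A (\<lambda>x. net_outflow G (g x) v)"
  unfolding net_outflow_def using assms by (intro continuous_intros) auto

text \<open>The \<open>GREATEST\<close> in \<open>max_flow\<close> is meaningful because the maximum
  is attained: suitably normalised flows form a compact set on which the value is
  continuous.\<close>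

lemma max_flow_attained:
  assumes "\<And>e. e \<in> arcs G \<Longrightarrow> 0 \<le> cap e"
  obtains f where "is_flow G cap a b f" "net_outflow G f a = max_flow G cap a b"
    and "\<And>g. is_flow G cap a b g \<Longrightarrow> net_outflow G g a \<le> max_flow G cap a b"
proof -
  \<comment> \<open>Values off the arcs are pinned to 0, since those coordinates would otherwise be
    unbounded; \<open>h\<close> below normalises an arbitrary flow in this way.\<close>
  define box where "box = {f :: 'b \<Rightarrow> real. \<forall>e. f e \<in> (if e \<in> arcs G then {0..cap e} else {0})}"
  define Z where "Z = {f. \<forall>v \<in> verts G - {a, b}. net_outflow G f v = 0}"
  have coord: "continuous_on A (\<lambda>f. f e)" for e :: 'b and A :: "('b \<Rightarrow> real) set"
    by (rule continuous_on_subset[OF continuous_on_product_coordinates]) simp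
  have cont: "continuous_on A (\<lambda>f. net_outflow G f v)" for A :: "('b \<Rightarrow> real) set" and v
    by (rule continuous_net_outflow) (rule coord)
  have "compact box"
    unfolding box_def by (rule compact_box) auto
  moreover have "closed Z"
  proof -
    have "closed {f. net_outflow G f v = 0}" for v
      by (rule closed_Collect_eq[OF cont continuous_on_const])
    moreover have "Z = (\<Inter>v\<in>verts G - {a, b}. {f. net_outflow G f v = 0})"
      by (auto simp: Z_def)
    ultimately show ?thesis by (auto intro!: closed_INT)
  qed
  ultimately have cpt: "compact (box \<inter> Z)" by (rule compact_Int_closed)
  have "(\<lambda>_. 0) \<in> box \<inter> Z"
    using assms by (auto simp: box_def Z_def net_outflow_def)
  then obtain f where f: "f \<in> box \<inter> Z"
    and max: "\<And>g. g \<in> box \<inter> Z \<Longrightarrow> net_outflow G g a \<le> net_outflow G f a"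
    using continuous_attains_sup[OF cpt, of "\<lambda>f. net_outflow G f a", OF _ cont] by blast
  have flow: "is_flow G cap a b f"
    using f by (auto simp: box_def Z_def is_flow_def split: if_splits)
  have le: "net_outflow G g a \<le> net_outflow G f a" if g: "is_flow G cap a b g" for g
  proof -
    define h where "h = (\<lambda>e. if e \<in> arcs G then g e else 0)"
    have "net_outflow G h = net_outflow G g"
      unfolding h_def net_outflow_def fun_eq_iff by (auto intro!: arg_cong2[where f="(-)"] sum.cong)
    moreover have "h \<in> box \<inter> Z"
      using g calculation by (auto simp: box_def Z_def is_flow_def h_def)
    ultimately show ?thesis using max[of h] by simp
  qed
  have "max_flow G cap a b = net_outflow G f a"
    unfolding max_flow_def by (rule Greatest_equality) (use flow le in auto)
  then show ?thesis using that[OF flow] le by simp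
qed

lemma flow_le_max_flow:
  assumes "\<And>e. e \<in> arcs G \<Longrightarrow> 0 \<le> cap e" "is_flow G cap a b f"
  shows "net_outflow G f a \<le> max_flow G cap a b"
proof -
  obtain g where "\<And>f. is_flow G cap a b f \<Longrightarrow> net_outflow G f a \<le> max_flow G cap a b"
    using max_flow_attained[of cap a b] assms(1) by blast
  then show ?thesis using assms(2) by blast
qed

end

section \<open>Solutions of two-pole circuits\<close>

locale circuit = fin_digraph G for G :: "('a, 'e) pre_digraph" (structure) +
  fixes mu :: "'e \<Rightarrow> real" and r s :: real
  assumes mu_pos: "e \<in> arcs G \<Longrightarrow> 0 < mu e"
    and r_pos: "0 < r" and s_pos: "0 < s"
begin

text \<open>Since \<open>0 powr r = 0\<close>, the case distinction is absorbed by the positive part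
  of the voltage. Monotonicity and continuity can be read off this form.\<close>

lemma current_eq: "current G mu r s x e = max 0 (voltage G x e) powr r / mu e powr s"
  by (auto simp: current_def max_def)

lemma current_nonneg: "0 \<le> current G mu r s x e"
  by (simp add: current_eq)

lemma current_mono:
  "voltage G x e \<le> voltage G x' e \<Longrightarrow> current G mu r s x e \<le> current G mu r s x' e"
  unfolding current_eq using r_pos by (intro divide_right_mono powr_mono2) auto

text \<open>Comparison principle. The difference \<open>d\<close> of the currents is tested against
  the positive part \<open>w\<close> of \<open>x - x'\<close>. The hypothesis makes the total
  nonpositive, while monotonicity of the current law makes each arc term nonnegative, so all terms
  vanish. At \<open>u\<close>, where \<open>w\<close> is 0, an arc has \<open>d = 0\<close> if
  \<open>w\<close> is positive at its other end; otherwise its voltages can be compared.\<close>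

lemma flux_comparison:
  assumes above: "\<And>v. v \<in> verts G \<Longrightarrow> x' v < x v \<Longrightarrow> flux G mu r s x v \<le> flux G mu r s x' v"
    and u: "u \<in> verts G" "x u = x' u"
  shows "flux G mu r s x' u \<le> flux G mu r s x u"
proof -
  define w where "w v = max 0 (x v - x' v)" for v
  define d where "d e = current G mu r s x e - current G mu r s x' e" for e
  have d: "flux G mu r s x v - flux G mu r s x' v = net_outflow G d v" for v
    by (simp add: flux_def net_outflow_def d_def sum_subtractf)
  have d_nonneg: "0 \<le> d e" if "voltage G x' e \<le> voltage G x e" for e
    using current_mono[OF that] by (simp add: d_def)
  have d_nonpos: "d e \<le> 0" if "voltage G x e \<le> voltage G x' e" for e
    using current_mono[OF that] by (simp add: d_def)
  have term_nonneg: "0 \<le> (w (tail G e) - w (head G e)) * d e" for e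
  proof (cases "w (head G e) \<le> w (tail G e)")
    case True
    then consider "w (head G e) = w (tail G e)" | "w (head G e) < w (tail G e)" by linarith
    then show ?thesis
    proof cases
      case 2
      then have "voltage G x' e \<le> voltage G x e"
        by (auto simp: w_def voltage_def max_def split: if_splits)
      then show ?thesis using 2 d_nonneg by simp
    qed simp
  next
    case False
    then have "voltage G x e \<le> voltage G x' e"
      by (auto simp: w_def voltage_def max_def split: if_splits)
    then show ?thesis using False d_nonpos by (simp add: mult_nonpos_nonpos)
  qed
  have "(\<Sum>v\<in>verts G. w v * net_outflow G d v) \<le> 0"
  proof (rule sum_nonpos)
    fix v assume v: "v \<in> verts G"
    show "w v * net_outflow G d v \<le> 0"
    proof (cases "x' v < x v")
      case True
      then have "net_outflow G d v \<le> 0" using above[OF v] d[of v] by simp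
      then show ?thesis by (simp add: w_def mult_nonneg_nonpos)
    qed (simp add: w_def)
  qed
  then have "(\<Sum>e\<in>arcs G. (w (tail G e) - w (head G e)) * d e) \<le> 0"
    by (simp add: sum_net_outflow)
  then have "(\<Sum>e\<in>arcs G. (w (tail G e) - w (head G e)) * d e) = 0"
    using term_nonneg by (intro antisym sum_nonneg) auto
  then have zero: "(w (tail G e) - w (head G e)) * d e = 0" if "e \<in> arcs G" for e
    using that term_nonneg by (subst (asm) sum_nonneg_eq_0_iff) auto
  have w_u: "w u = 0" using u by (simp add: w_def)
  have "0 \<le> d e" if e: "e \<in> out_arcs G u" for e
  proof (cases "w (head G e) = 0")
    case True
    then have "voltage G x' e \<le> voltage G x e"
      using e u by (auto simp: w_def voltage_def)
    then show ?thesis by (rule d_nonneg)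
  next
    case False
    then show ?thesis using zero[of e] e w_u by simp
  qed
  moreover have "d e \<le> 0" if e: "e \<in> in_arcs G u" for e
  proof (cases "w (tail G e) = 0")
    case True
    then have "voltage G x e \<le> voltage G x' e"
      using e u by (auto simp: w_def voltage_def)
    then show ?thesis by (rule d_nonpos)
  next
    case False
    then show ?thesis using zero[of e] e w_u by simp
  qed
  ultimately have "0 \<le> net_outflow G d u"
    using sum_nonneg[of "out_arcs G u" d] sum_nonpos[of "in_arcs G u" d]
    by (simp add: net_outflow_def)
  then show ?thesis using d[of u] by simp
qed

text \<open>The hypothesis of the comparison principle is vacuous here, as \<open>x'\<close> is
  nowhere below \<open>x\<close>.\<close>

lemma flux_antimono:
  assumes "\<And>v. v \<in> verts G \<Longrightarrow> x v \<le> x' v" "u \<in> verts G" "x u = x' u"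
  shows "flux G mu r s x' u \<le> flux G mu r s x u"
proof (rule flux_comparison)
  fix v assume "v \<in> verts G" "x' v < x v"
  then show "flux G mu r s x v \<le> flux G mu r s x' v" using assms(1)[of v] by simp
qed (use assms in auto)

section \<open>Existence of solutions by Perron's method\<close>

lemma continuous_flux:
  assumes "\<And>v. continuous_on A (\<lambda>z. X z v)"
  shows "continuous_on A (\<lambda>z. flux G mu r s (X z) u)"
  unfolding flux_def
proof (rule continuous_net_outflow)
  fix e assume "e \<in> arcs G"
  then have "mu e powr s \<noteq> 0" using mu_pos[of e] by simp
  then show "continuous_on A (\<lambda>z. current G mu r s (X z) e)"
    unfolding current_eq voltage_def using r_pos assms
    by (intro continuous_intros continuous_on_powr') auto
qed

text \<open>The bounds on the potentials are imposed explicitly: a vertex without arcs, for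
  instance, could have any potential in a two-pole solution.\<close>

definition unit_solution :: "'a \<Rightarrow> 'a \<Rightarrow> ('a \<Rightarrow> real) \<Rightarrow> bool" where
  "unit_solution a b x \<longleftrightarrow> x a = 1 \<and> x b = 0 \<and> (\<forall>v\<in>verts G. 0 \<le> x v \<and> x v \<le> 1) \<and>
     (\<forall>v\<in>verts G - {a, b}. flux G mu r s x v = 0)"

text \<open>Perron's method: a subsolution whose potentials have maximal sum is a solution,
  since a potential with negative flux could be raised.\<close>

lemma unit_solution_exists:
  assumes "a \<in> verts G" "b \<in> verts G" "a \<noteq> b"
  shows "\<exists>x. unit_solution a b x"
proof -
  \<comment> \<open>The poles are fixed at 1 and 0; potentials off the graph are fixed at 0 to keep
    the box compact.\<close>
  define I where "I v = (if v = a then {1::real} else if v = b then {0}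
    else if v \<in> verts G then {0..1} else {0})" for v
  define box where "box = {x. \<forall>v. x v \<in> I v}"
  define Z where "Z = (\<Inter>v\<in>verts G - {a, b}. {x. flux G mu r s x v \<le> 0})"
  have coord: "continuous_on A (\<lambda>x. x v)" for v :: 'a and A :: "('a \<Rightarrow> real) set"
    by (rule continuous_on_subset[OF continuous_on_product_coordinates]) simp
  have "compact box"
    unfolding box_def by (rule compact_box) (auto simp: I_def)
  moreover have "closed {x. flux G mu r s x v \<le> 0}" for v
    by (rule closed_Collect_le[OF continuous_flux continuous_on_const]) (rule coord)
  then have "closed Z" by (auto simp: Z_def)
  ultimately have cpt: "compact (box \<inter> Z)" by (rule compact_Int_closed)
  have box: "x a = 1 \<and> x b = 0 \<and> (\<forall>v\<in>verts G. 0 \<le> x v \<and> x v \<le> 1)" if "x \<in> box" for x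
  proof -
    have "x v \<in> I v" for v using that by (simp add: box_def)
    from this[of a] this[of b] have ab: "x a = 1" "x b = 0" using assms by (auto simp: I_def)
    have "0 \<le> x v \<and> x v \<le> 1" if "v \<in> verts G" for v
      using \<open>\<And>v. x v \<in> I v\<close>[of v] that by (auto simp: I_def split: if_splits)
    with ab show ?thesis by blast
  qed
  have no_in: "0 \<le> flux G mu r s x v" if "\<And>e. e \<in> in_arcs G v \<Longrightarrow> voltage G x e \<le> 0" for x v
  proof -
    have "current G mu r s x e = 0" if "e \<in> in_arcs G v" for e
      using \<open>\<And>e. e \<in> in_arcs G v \<Longrightarrow> voltage G x e \<le> 0\<close>[OF that] by (simp add: current_eq max_def)
    then show ?thesis
      using sum_nonneg[of "out_arcs G v" "current G mu r s x"] current_nonneg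
      by (simp add: flux_def net_outflow_def)
  qed
  have no_out: "flux G mu r s x v \<le> 0" if "\<And>e. e \<in> out_arcs G v \<Longrightarrow> voltage G x e \<le> 0" for x v
  proof -
    have "current G mu r s x e = 0" if "e \<in> out_arcs G v" for e
      using \<open>\<And>e. e \<in> out_arcs G v \<Longrightarrow> voltage G x e \<le> 0\<close>[OF that] by (simp add: current_eq max_def)
    then show ?thesis
      using sum_nonneg[of "in_arcs G v" "current G mu r s x"] current_nonneg
      by (simp add: flux_def net_outflow_def)
  qed
  \<comment> \<open>The indicator of \<open>a\<close> is a subsolution, because a vertex at
    potential 0 emits no current. So the maximum is taken over a nonempty set.\<close>
  have "(\<lambda>v. if v = a then 1 else 0) \<in> box \<inter> Z"
    using assms by (auto simp: box_def I_def Z_def voltage_def split: if_splits intro!: no_out)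
  then have ne: "box \<inter> Z \<noteq> {}" by blast
  have cont: "continuous_on (box \<inter> Z) (\<lambda>x. \<Sum>v\<in>verts G. x v)"
    by (intro continuous_on_sum coord)
  from continuous_attains_sup[OF cpt ne cont] obtain x where x: "x \<in> box \<inter> Z"
    and max: "\<And>y. y \<in> box \<inter> Z \<Longrightarrow> (\<Sum>v\<in>verts G. y v) \<le> (\<Sum>v\<in>verts G. x v)"
    by (elim bexE) simp
  have "flux G mu r s x v = 0" if v: "v \<in> verts G - {a, b}" for v
  proof (rule ccontr)
    assume "flux G mu r s x v \<noteq> 0"
    then have neg: "flux G mu r s x v < 0" using x v by (force simp: Z_def)
    \<comment> \<open>A vertex at the top potential 1 receives no current, so its flux cannot be
      negative. Hence there is room to raise \<open>v\<close>.\<close>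
    have "x v \<noteq> 1"
    proof
      assume 1: "x v = 1"
      have "0 \<le> flux G mu r s x v"
      proof (rule no_in)
        fix e assume "e \<in> in_arcs G v"
        then have "head G e = v" "tail G e \<in> verts G" by auto
        then show "voltage G x e \<le> 0" using box[of x] x 1 by (simp add: voltage_def)
      qed
      then show False using neg by simp
    qed
    moreover have "x v \<le> 1" using box[of x] x v by simp
    ultimately have less1: "x v < 1" by simp
    have cont: "continuous_on UNIV (\<lambda>h. (x(v := h)) u)" for u
      by (cases "u = v") auto
    define U where "U = {h. flux G mu r s (x(v := h)) v < 0}"
    have "open U"
      unfolding U_def by (rule open_Collect_less[OF continuous_flux continuous_on_const]) (rule cont)
    moreover have "x v \<in> U" using neg by (simp add: U_def)
    ultimately obtain \<delta> where \<delta>: "\<delta> > 0" and ball: "\<And>h. dist h (x v) < \<delta> \<Longrightarrow> h \<in> U"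
      unfolding open_dist by blast
    \<comment> \<open>Half the radius keeps \<open>h\<close> inside the ball where the flux at
      \<open>v\<close> stays negative; the cap 1 keeps it inside the box.\<close>
    define h where "h = min 1 (x v + \<delta> / 2)"
    have h: "x v < h" "h \<le> 1" "dist h (x v) < \<delta>"
      using less1 \<delta> by (auto simp: h_def dist_real_def min_def)
    let ?y = "x(v := h)"
    have "?y \<in> box"
    proof -
      have "h \<in> I v" using x v h box[of x] by (auto simp: I_def intro: order.trans less_imp_le)
      moreover have "x u \<in> I u" for u using x by (simp add: box_def)
      ultimately show ?thesis by (simp add: box_def)
    qed
    moreover have "?y \<in> Z"
    proof -
      have "flux G mu r s ?y u \<le> 0" if u: "u \<in> verts G - {a, b}" for u
      proof (cases "u = v")
        case True
        then show ?thesis using ball[OF h(3)] by (simp add: U_def)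
      next
        case False
        have "flux G mu r s ?y u \<le> flux G mu r s x u"
          using False u h by (intro flux_antimono) auto
        also have "\<dots> \<le> 0" using x u by (auto simp: Z_def)
        finally show ?thesis .
      qed
      then show ?thesis by (auto simp: Z_def)
    qed
    ultimately have "(\<Sum>v\<in>verts G. ?y v) \<le> (\<Sum>v\<in>verts G. x v)" by (intro max IntI)
    moreover have "(\<Sum>v\<in>verts G. x v) < (\<Sum>v\<in>verts G. ?y v)"
      using h v by (intro sum_strict_mono_ex1) (auto intro!: bexI[of _ v])
    ultimately show False by simp
  qed
  moreover have "x \<in> box" using x by simp
  ultimately have "unit_solution a b x" using box[of x] by (simp add: unit_solution_def)
  then show ?thesis by blast
qed

end

text \<open>This is the series law with \<open>q = s / r\<close>: if every arc of a path carries the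
  current \<open>C\<close>, the voltages are \<open>C powr (1 / r) * mu e powr q\<close>, and making
  them add up to 1 gives \<open>C powr (-1 / s)\<close> as the resistance of the path.\<close>

definition path_norm :: "('e \<Rightarrow> real) \<Rightarrow> real \<Rightarrow> 'e list \<Rightarrow> real" where
  "path_norm mu q p = (\<Sum>e\<leftarrow>p. mu e powr q) powr (1 / q)"

context wf_digraph
begin

lemma sum_voltage_awalk: "awalk u p v \<Longrightarrow> (\<Sum>e\<leftarrow>p. voltage G x e) = x u - x v"
  by (induction p arbitrary: u) (auto simp: awalk_Nil_iff awalk_Cons_iff voltage_def)

lemma sum_list_pos_awalk:
  assumes "awalk a p b" "a \<noteq> b" "\<And>e. e \<in> arcs G \<Longrightarrow> 0 < (f e :: real)"
  shows "0 < (\<Sum>e\<leftarrow>p. f e)"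
proof -
  have "p \<noteq> []" using assms by (auto simp: awalk_Nil_iff)
  moreover have "set p \<subseteq> arcs G" using assms by auto
  ultimately show ?thesis
  proof (induction p)
    case (Cons e p)
    then show ?case using assms(3)[of e] by (cases p) (auto intro: add_pos_pos)
  qed simp
qed

end

section \<open>Conductance, effective resistance and their path estimates\<close>

context circuit
begin

text \<open>The choice by \<open>SOME\<close> does no harm: \<open>two_pole_flux_unique\<close>
  shows that all unit solutions have the same flux.\<close>

definition conductance :: "'a \<Rightarrow> 'a \<Rightarrow> real" where
  "conductance a b = flux G mu r s (SOME x. unit_solution a b x) a"

lemma unit_solution_two_pole: "unit_solution a b x \<Longrightarrow> two_pole_solution G mu r s a b 1 0 x"
  by (simp add: unit_solution_def two_pole_solution_def)

text \<open>Two solutions can differ only away from the poles, where both fluxes vanish, so the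
  comparison principle applies in both directions. The potentials themselves need not agree.\<close>

lemma two_pole_flux_unique:
  assumes "two_pole_solution G mu r s a b xa xb x" "two_pole_solution G mu r s a b xa xb x'"
    and "a \<in> verts G"
  shows "flux G mu r s x a = flux G mu r s x' a"
proof (rule antisym)
  have eq: "flux G mu r s x v = flux G mu r s x' v" if "v \<in> verts G" "x v \<noteq> x' v" for v
  proof -
    have "v \<in> verts G - {a, b}" using that assms by (auto simp: two_pole_solution_def)
    then show ?thesis using assms by (simp add: two_pole_solution_def)
  qed
  have a: "x a = x' a" using assms by (simp add: two_pole_solution_def)
  show "flux G mu r s x a \<le> flux G mu r s x' a"
    by (rule flux_comparison) (use eq a assms(3) in auto)
  show "flux G mu r s x' a \<le> flux G mu r s x a"
    by (rule flux_comparison) (use eq a assms(3) in auto)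
qed

lemma flux_unit_solution:
  assumes "unit_solution a b x" "a \<in> verts G"
  shows "flux G mu r s x a = conductance a b"
  unfolding conductance_def
  by (rule two_pole_flux_unique) (use assms someI[of "unit_solution a b" x] unit_solution_two_pole in auto)

text \<open>The current law is homogeneous of degree \<open>r\<close> and sees only potential
  differences. Rescaling a unit solution thus yields the power law in
  \<open>two_pole_flux\<close>.\<close>

lemma flux_affine:
  assumes "0 \<le> c"
  shows "flux G mu r s (\<lambda>v. c * x v + d) u = c powr r * flux G mu r s x u"
proof -
  have "max 0 (c * y) = c * max 0 y" for y :: real
    using assms by (simp add: max_def mult_le_0_iff zero_le_mult_iff)
  moreover have "voltage G (\<lambda>v. c * x v + d) e = c * voltage G x e" for e
    by (simp add: voltage_def right_diff_distrib)
  ultimately have "current G mu r s (\<lambda>v. c * x v + d) e = c powr r * current G mu r s x e" for e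
    using assms by (simp add: current_eq powr_mult)
  then show ?thesis by (simp add: flux_def net_outflow_def sum_distrib_left right_diff_distrib)
qed

lemma two_pole_flux:
  assumes "two_pole_solution G mu r s a b xa xb x" "xb \<le> xa"
    and ab: "a \<in> verts G" "b \<in> verts G" "a \<noteq> b"
  shows "flux G mu r s x a = (xa - xb) powr r * conductance a b"
proof -
  obtain y where y: "unit_solution a b y" using unit_solution_exists[OF ab] by blast
  let ?y = "\<lambda>v. (xa - xb) * y v + xb"
  have "two_pole_solution G mu r s a b xa xb ?y"
    using y assms by (simp add: two_pole_solution_def unit_solution_def flux_affine)
  then have "flux G mu r s x a = flux G mu r s ?y a"
    by (rule two_pole_flux_unique[OF assms(1) _ ab(1)])
  then show ?thesis using assms y by (simp add: flux_affine flux_unit_solution)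
qed

text \<open>By summation by parts, the conductance is the dissipated power, a sum of nonnegative
  terms. A path from potential 1 to potential 0 contains an arc of positive voltage, whose term is
  positive.\<close>

lemma conductance_pos:
  assumes "a \<rightarrow>\<^sup>* b" "a \<noteq> b"
  shows "0 < conductance a b"
proof -
  have ab: "a \<in> verts G" "b \<in> verts G" using assms reachable_in_verts by auto
  obtain x where x: "unit_solution a b x" using unit_solution_exists[OF ab assms(2)] by blast
  have "conductance a b = (\<Sum>v\<in>{a}. x v * flux G mu r s x v)"
    using x ab by (simp add: flux_unit_solution[symmetric]) (simp add: unit_solution_def)
  also have "\<dots> = (\<Sum>v\<in>verts G. x v * flux G mu r s x v)"
    using x ab by (intro sum.mono_neutral_left) (auto simp: unit_solution_def)
  also have "\<dots> = (\<Sum>e\<in>arcs G. voltage G x e * current G mu r s x e)"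
    by (simp add: flux_def sum_net_outflow voltage_def)
  finally have C: "conductance a b = (\<Sum>e\<in>arcs G. voltage G x e * current G mu r s x e)" .
  have nonneg: "0 \<le> voltage G x e * current G mu r s x e" for e
    by (auto simp: current_def)
  obtain p where p: "awalk a p b" using assms reachable_awalk by blast
  have "\<exists>e\<in>set p. 0 < voltage G x e"
  proof (rule ccontr)
    assume "\<not> (\<exists>e\<in>set p. 0 < voltage G x e)"
    then have "(\<Sum>e\<leftarrow>p. voltage G x e) \<le> 0"
      by (intro sum_list_nonpos) (auto simp: not_less)
    then show False using sum_voltage_awalk[OF p, of x] x by (simp add: unit_solution_def)
  qed
  then obtain e where e: "e \<in> arcs G" "0 < voltage G x e" using p by auto
  then have "0 < voltage G x e * current G mu r s x e"
    using mu_pos[of e] by (simp add: current_def)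
  also have "\<dots> \<le> conductance a b"
    unfolding C using e nonneg by (intro member_le_sum) auto
  finally show ?thesis .
qed

text \<open>The unit voltage alone forces \<open>1 / m powr s\<close> to be the conductance;
  conversely, homogeneity gives the law at every other voltage.\<close>

lemma is_resistance_iff:
  assumes "a \<rightarrow>\<^sup>* b" "a \<noteq> b"
  shows "is_resistance G mu r s a b m \<longleftrightarrow> m = conductance a b powr (-1 / s)"
proof
  have ab: "a \<in> verts G" "b \<in> verts G" using assms reachable_in_verts by auto
  note pos = conductance_pos[OF assms]
  show "m = conductance a b powr (-1 / s)" if m: "is_resistance G mu r s a b m"
  proof -
    obtain x where x: "unit_solution a b x" using unit_solution_exists[OF ab assms(2)] by blast
    have "flux G mu r s x a = (1 - 0) powr r / m powr s"
      using m unit_solution_two_pole[OF x] unfolding is_resistance_def by (metis zero_le_one)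
    then have "conductance a b = 1 / m powr s" using flux_unit_solution[OF x ab(1)] by simp
    moreover have "0 < m" using m by (simp add: is_resistance_def)
    ultimately have "conductance a b = m powr (- s)" "0 < m" by (auto simp: powr_minus_divide)
    then show ?thesis using s_pos by (simp add: powr_powr)
  qed
  show "is_resistance G mu r s a b m" if "m = conductance a b powr (-1 / s)"
  proof -
    have "m powr s = conductance a b powr (-1)"
      unfolding that using s_pos by (subst powr_powr) simp
    then have "m powr s = inverse (conductance a b)"
      using pos by (simp add: powr_minus)
    then show ?thesis
      using pos that two_pole_flux ab assms by (auto simp: is_resistance_def field_simps)
  qed
qed

lemma effective_resistance_eq:
  "effective_resistance G mu r s a b = (if a = b then 0
     else if a \<rightarrow>\<^sup>* b then ereal (conductance a b powr (-1 / s)) else \<infinity>)"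
proof -
  have "(THE m. is_resistance G mu r s a b m) = conductance a b powr (-1 / s)"
    if "a \<rightarrow>\<^sup>* b" "a \<noteq> b"
    by (rule the_equality) (simp_all add: is_resistance_iff[OF that])
  then show ?thesis by (simp add: effective_resistance_def)
qed

text \<open>A unit solution for \<open>(a, c)\<close> is rescaled to agree with \<open>x\<close> at
  \<open>a\<close> and \<open>c\<close>. Where it lies below \<open>x\<close>, its flux is 0 and
  that of \<open>x\<close> is at most 0, as \<open>a\<close> is excluded and \<open>b\<close> only
  absorbs. Comparison at \<open>a\<close> gives the first bound; the second is dual, with comparison
  at \<open>b\<close>.\<close>

lemma conductance_ge_segments:
  assumes x: "unit_solution a b x" and abc: "a \<rightarrow>\<^sup>* b" "c \<in> verts G" "a \<noteq> b" "a \<noteq> c" "c \<noteq> b"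
  shows "(1 - x c) powr r * conductance a c \<le> conductance a b"
    and "x c powr r * conductance c b \<le> conductance a b"
proof -
  have ab: "a \<in> verts G" "b \<in> verts G" using abc reachable_in_verts by auto
  have range: "0 \<le> x c" "x c \<le> 1" using x abc by (auto simp: unit_solution_def)
  have flux_a: "flux G mu r s x a = conductance a b" using flux_unit_solution[OF x ab(1)] .
  have flux_b: "flux G mu r s x b = - conductance a b"
    using net_outflow_source_sink[OF _ ab abc(3), of "current G mu r s x"] x flux_a
    by (auto simp: unit_solution_def flux_def)
  note pos = conductance_pos[OF abc(1,3)]
  show "(1 - x c) powr r * conductance a c \<le> conductance a b"
  proof -
    obtain y where y: "unit_solution a c y" using unit_solution_exists[OF ab(1) abc(2,4)] by blast
    let ?y = "\<lambda>v. (1 - x c) * y v + x c"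
    have flux: "flux G mu r s ?y v = (1 - x c) powr r * flux G mu r s y v" for v
      using range by (intro flux_affine) simp
    have "flux G mu r s ?y a \<le> flux G mu r s x a"
    proof (rule flux_comparison)
      fix v assume v: "v \<in> verts G" "?y v < x v"
      then have "v \<noteq> a" "v \<noteq> c" using y x by (auto simp: unit_solution_def)
      then have "flux G mu r s ?y v = 0" using y v by (auto simp: unit_solution_def flux)
      moreover have "flux G mu r s x v \<le> 0"
        using x v \<open>v \<noteq> a\<close> pos flux_b by (cases "v = b") (auto simp: unit_solution_def)
      ultimately show "flux G mu r s x v \<le> flux G mu r s ?y v" by simp
    qed (use x y ab in \<open>auto simp: unit_solution_def\<close>)
    then show ?thesis using flux flux_a flux_unit_solution[OF y ab(1)] by simp
  qed
  show "x c powr r * conductance c b \<le> conductance a b"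
  proof -
    obtain y where y: "unit_solution c b y" using unit_solution_exists[OF abc(2) ab(2) abc(5)] by blast
    let ?y = "\<lambda>v. x c * y v + 0"
    have flux: "flux G mu r s ?y v = x c powr r * flux G mu r s y v" for v
      using range by (intro flux_affine) simp
    have "flux G mu r s x b \<le> flux G mu r s ?y b"
    proof (rule flux_comparison)
      fix v assume v: "v \<in> verts G" "x v < ?y v"
      then have "v \<noteq> c" "v \<noteq> b" using y x by (auto simp: unit_solution_def)
      then have "flux G mu r s ?y v = 0" unfolding flux using y v by (auto simp: unit_solution_def)
      moreover have "0 \<le> flux G mu r s x v"
        using x v \<open>v \<noteq> b\<close> pos flux_a by (cases "v = a") (auto simp: unit_solution_def)
      ultimately show "flux G mu r s ?y v \<le> flux G mu r s x v" by simp
    qed (use x y ab in \<open>auto simp: unit_solution_def\<close>)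
    moreover have "flux G mu r s y b = - conductance c b"
      using net_outflow_source_sink[OF _ abc(2) ab(2) abc(5), of "current G mu r s y"] y
        flux_unit_solution[OF y abc(2)]
      by (auto simp: unit_solution_def flux_def)
    ultimately show ?thesis using flux flux_b by simp
  qed
qed

text \<open>Arcs entering a level set run uphill and carry no current, so there is no return term.
  The bounds on \<open>c\<close> put \<open>a\<close> inside and \<open>b\<close> outside.\<close>

lemma conductance_eq_level_cut:
  assumes x: "unit_solution a b x" and "a \<in> verts G" "0 < c" "c \<le> 1"
  shows "conductance a b = cut_value (current G mu r s x) {v \<in> verts G. c \<le> x v}"
proof -
  let ?S = "{v \<in> verts G. c \<le> x v}"
  have "(\<Sum>e | e \<in> arcs G \<and> tail G e \<notin> ?S \<and> head G e \<in> ?S. current G mu r s x e) = 0"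
    by (intro sum.neutral) (auto simp: current_def voltage_def)
  moreover have "net_outflow G (current G mu r s x) a = cut_value (current G mu r s x) ?S
      - (\<Sum>e | e \<in> arcs G \<and> tail G e \<notin> ?S \<and> head G e \<in> ?S. current G mu r s x e)"
    using assms by (intro net_outflow_eq_cut[where b=b]) (auto simp: unit_solution_def flux_def)
  ultimately show ?thesis using flux_unit_solution[OF assms(1,2)] by (simp add: flux_def)
qed

text \<open>An arc of positive voltage leaves the level set at the height of its tail, and the whole
  current through that cut is the conductance.\<close>

lemma current_le_conductance:
  assumes x: "unit_solution a b x" and ab: "a \<rightarrow>\<^sup>* b" "a \<noteq> b" and e: "e \<in> arcs G"
  shows "current G mu r s x e \<le> conductance a b"
proof (cases "0 < voltage G x e")
  case True
  let ?c = "x (tail G e)"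
  have "tail G e \<in> verts G" "head G e \<in> verts G" using e by auto
  then have "0 < ?c" "?c \<le> 1" using True x by (auto simp: unit_solution_def voltage_def less_le_trans)
  then have "conductance a b = cut_value (current G mu r s x) {v \<in> verts G. ?c \<le> x v}"
    using x ab reachable_in_verts(1) by (intro conductance_eq_level_cut) auto
  also have "current G mu r s x e \<le> \<dots>"
    unfolding cut_value_def using e True current_nonneg
    by (intro member_le_sum) (auto simp: voltage_def)
  finally show ?thesis .
next
  case False
  then have "current G mu r s x e = 0" by (simp add: current_eq max_def)
  then show ?thesis using conductance_pos[OF ab] by simp
qed

text \<open>A level-set cut always contains an arc carrying at least the average current, so
  such arcs connect the poles.\<close>

lemma heavy_path_exists:
  assumes x: "unit_solution a b x" and ab: "a \<rightarrow>\<^sup>* b" "a \<noteq> b"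
  obtains p where "apath a p b"
    and "\<And>e. e \<in> set p \<Longrightarrow> conductance a b / card (arcs G) \<le> current G mu r s x e"
proof -
  let ?C = "conductance a b" and ?N = "real (card (arcs G))"
  have a: "a \<in> verts G" using ab reachable_in_verts by auto
  \<comment> \<open>\<open>S\<close> collects the vertices reached from \<open>a\<close> along heavy
    arcs only. If it missed \<open>b\<close>, every arc leaving it would be light.\<close>
  define S where "S = {v. \<exists>p. awalk a p v \<and> (\<forall>e\<in>set p. ?C / ?N \<le> current G mu r s x e)}"
  have "b \<in> S"
  proof (rule ccontr)
    assume b: "b \<notin> S"
    have "S \<subseteq> verts G" by (auto simp: S_def)
    moreover have "a \<in> S" using a by (auto simp: S_def awalk_Nil_iff intro!: exI[of _ "[]"])
    ultimately have "net_outflow G (current G mu r s x) a \<le> cut_value (current G mu r s x) S"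
      using b x current_nonneg
      by (intro net_outflow_le_cut[where b=b]) (auto simp: unit_solution_def flux_def)
    then have le: "?C \<le> cut_value (current G mu r s x) S"
      using flux_unit_solution[OF x a] by (simp add: flux_def)
    let ?cut = "{e. e \<in> arcs G \<and> tail G e \<in> S \<and> head G e \<notin> S}"
    have small: "current G mu r s x e < ?C / ?N" if "e \<in> ?cut" for e
    proof (rule ccontr)
      assume "\<not> current G mu r s x e < ?C / ?N"
      moreover obtain p where "awalk a p (tail G e)" "\<forall>e\<in>set p. ?C / ?N \<le> current G mu r s x e"
        using \<open>e \<in> ?cut\<close> by (auto simp: S_def)
      ultimately have "awalk a (p @ [e]) (head G e) \<and>
          (\<forall>e\<in>set (p @ [e]). ?C / ?N \<le> current G mu r s x e)"
        using that arc_implies_awalk[of e] by auto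
      then have "head G e \<in> S" unfolding S_def by blast
      then show False using that by simp
    qed
    have ne: "?cut \<noteq> {}"
      using le conductance_pos[OF ab] by (auto simp: cut_value_def simp del: Collect_empty_eq)
    \<comment> \<open>At most \<open>?N\<close> arcs, each carrying less than
      \<open>?C / ?N\<close>, cannot carry \<open>?C\<close>. Strictness uses that the cut is
      nonempty.\<close>
    then have "cut_value (current G mu r s x) S < (\<Sum>e\<in>?cut. ?C / ?N)"
      unfolding cut_value_def by (intro sum_strict_mono small) auto
    also have "\<dots> \<le> (\<Sum>e\<in>arcs G. ?C / ?N)"
      using conductance_pos[OF ab] by (intro sum_mono2) auto
    also have "\<dots> = ?C"
      using ne by auto
    finally show False using le by simp
  qed
  then obtain p where p: "awalk a p b" "\<forall>e\<in>set p. ?C / ?N \<le> current G mu r s x e"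
    by (auto simp: S_def)
  then show thesis
    using that[of "awalk_to_apath p"] apath_awalk_to_apath[OF p(1)] awalk_to_apath_subset[OF p(1)]
    by blast
qed

text \<open>No arc carries more than the conductance, so inverting the current law bounds each
  voltage from above; along the path the voltages add up to 1.\<close>

lemma resistance_le_path_norm:
  assumes p: "awalk a p b" and ab: "a \<noteq> b"
  shows "conductance a b powr (-1 / s) \<le> path_norm mu (s / r) p"
proof -
  let ?C = "conductance a b"
  have reach: "a \<rightarrow>\<^sup>* b" using p reachable_awalk by blast
  then have verts: "a \<in> verts G" "b \<in> verts G" using reachable_in_verts by auto
  obtain x where x: "unit_solution a b x" using unit_solution_exists[OF verts ab] by blast
  note C = conductance_pos[OF reach ab]
  have "voltage G x e \<le> ?C powr (1 / r) * mu e powr (s / r)" if e: "e \<in> arcs G" for e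
  proof (cases "0 < voltage G x e")
    case True
    have "voltage G x e powr r / mu e powr s \<le> ?C"
      using current_le_conductance[OF x reach ab e] True by (simp add: current_def)
    then have "voltage G x e powr r \<le> ?C * mu e powr s"
      using mu_pos[OF e] by (simp add: divide_simps)
    then have "(voltage G x e powr r) powr (1 / r) \<le> (?C * mu e powr s) powr (1 / r)"
      using r_pos by (intro powr_mono2) auto
    then show ?thesis using True r_pos C by (simp add: powr_powr powr_mult)
  next
    case False
    then show ?thesis using C by (simp add: order.trans[of _ 0])
  qed
  then have "(\<Sum>e\<leftarrow>p. voltage G x e) \<le> (\<Sum>e\<leftarrow>p. ?C powr (1 / r) * mu e powr (s / r))"
    using p by (intro sum_list_mono) (auto simp: awalk_def)
  then have "1 \<le> ?C powr (1 / r) * (\<Sum>e\<leftarrow>p. mu e powr (s / r))"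
    using sum_voltage_awalk[OF p, of x] x
    by (simp add: unit_solution_def sum_list_const_mult)
  then have "?C powr (- 1 / r) \<le> (\<Sum>e\<leftarrow>p. mu e powr (s / r))"
    using C by (simp add: powr_minus field_simps)
  then have "(?C powr (- 1 / r)) powr (1 / (s / r)) \<le> path_norm mu (s / r) p"
    unfolding path_norm_def using r_pos s_pos by (intro powr_mono2) auto
  then show ?thesis using r_pos by (simp add: powr_powr)
qed

text \<open>Along a heavy path the estimate reverses: each arc carries at least the average current,
  and replacing the conductance by this average costs the factor
  \<open>card (arcs G) powr (1 / s)\<close>.\<close>

lemma path_norm_le_resistance:
  assumes ab: "a \<rightarrow>\<^sup>* b" "a \<noteq> b"
  obtains p where "apath a p b"
    and "path_norm mu (s / r) p \<le> card (arcs G) powr (1 / s) * conductance a b powr (-1 / s)"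
proof -
  let ?C = "conductance a b" and ?N = "real (card (arcs G))"
  have verts: "a \<in> verts G" "b \<in> verts G" using ab reachable_in_verts by auto
  obtain x where x: "unit_solution a b x" using unit_solution_exists[OF verts ab(2)] by blast
  obtain p where p: "apath a p b" "\<And>e. e \<in> set p \<Longrightarrow> ?C / ?N \<le> current G mu r s x e"
    using heavy_path_exists[OF x ab] by blast
  have walk: "awalk a p b" using p by (simp add: apath_def)
  have arcs: "set p \<subseteq> arcs G" using walk by auto
  have "p \<noteq> []" using walk ab by (auto simp: awalk_Nil_iff)
  then have "arcs G \<noteq> {}" using arcs by auto
  then have N: "0 < ?N" using finite_arcs by (simp add: card_gt_0_iff)
  then have CN: "0 < ?C / ?N" using conductance_pos[OF ab] by simp
  have "(?C / ?N) powr (1 / r) * mu e powr (s / r) \<le> voltage G x e" if e: "e \<in> set p" for e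
  proof -
    have mu: "0 < mu e" using e arcs mu_pos by auto
    have cur: "0 < current G mu r s x e" using CN p(2)[OF e] by simp
    then have v: "0 < voltage G x e"
      by (cases "voltage G x e" "0::real" rule: linorder_cases) (auto simp: current_def)
    then have "?C / ?N \<le> voltage G x e powr r / mu e powr s"
      using p(2)[OF e] by (simp add: current_def)
    then have "(?C / ?N) * mu e powr s \<le> voltage G x e powr r"
      using mu by (simp add: pos_le_divide_eq)
    then have "((?C / ?N) * mu e powr s) powr (1 / r) \<le> (voltage G x e powr r) powr (1 / r)"
      using r_pos conductance_pos[OF ab] by (intro powr_mono2) auto
    moreover have "((?C / ?N) * mu e powr s) powr (1 / r) = (?C / ?N) powr (1 / r) * mu e powr (s / r)"
      using CN by (subst powr_mult) (auto simp: powr_powr)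
    ultimately show ?thesis using v r_pos by (simp add: powr_powr)
  qed
  then have "(\<Sum>e\<leftarrow>p. (?C / ?N) powr (1 / r) * mu e powr (s / r)) \<le> (\<Sum>e\<leftarrow>p. voltage G x e)"
    by (intro sum_list_mono) auto
  then have "(?C / ?N) powr (1 / r) * (\<Sum>e\<leftarrow>p. mu e powr (s / r)) \<le> 1"
    using sum_voltage_awalk[OF walk, of x] x
    by (simp add: unit_solution_def sum_list_const_mult)
  moreover have "0 < (?C / ?N) powr (1 / r)"
    using conductance_pos[OF ab] \<open>arcs G \<noteq> {}\<close> by simp
  ultimately have "(\<Sum>e\<leftarrow>p. mu e powr (s / r)) \<le> (?C / ?N) powr (- (1 / r))"
    unfolding powr_minus inverse_eq_divide by (subst pos_le_divide_eq) (simp_all add: mult.commute)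
  moreover have "0 \<le> (\<Sum>e\<leftarrow>p. mu e powr (s / r))" by (intro sum_list_nonneg) auto
  ultimately have "path_norm mu (s / r) p \<le> ((?C / ?N) powr (- (1 / r))) powr (1 / (s / r))"
    unfolding path_norm_def using r_pos s_pos by (intro powr_mono2) auto
  also have "\<dots> = (?C / ?N) powr (- 1 / s)"
    using r_pos by (simp add: powr_powr)
  also have "\<dots> = ?N powr (1 / s) * ?C powr (- 1 / s)"
    using N conductance_pos[OF ab] by (simp add: powr_divide powr_minus divide_simps)
  finally show thesis using that p(1) by blast
qed

end

section \<open>Shortest and widest paths\<close>

lemma tendsto_Min_image:
  fixes f :: "'i \<Rightarrow> 'b \<Rightarrow> real"
  assumes "finite I" "I \<noteq> {}" "\<And>i. i \<in> I \<Longrightarrow> (f i \<longlongrightarrow> l i) F"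
  shows "((\<lambda>t. Min ((\<lambda>i. f i t) ` I)) \<longlongrightarrow> Min (l ` I)) F"
  using assms
proof (induction I rule: finite_ne_induct)
  case (insert i I)
  then have "((\<lambda>t. min (f i t) (Min ((\<lambda>i. f i t) ` I))) \<longlongrightarrow> min (l i) (Min (l ` I))) F"
    by (intro tendsto_min) auto
  then show ?case using insert by simp
qed simp

lemma Min_image_attained:
  fixes f :: "'i \<Rightarrow> real"
  assumes "finite I" "I \<noteq> {}"
  shows "\<exists>i\<in>I. Min (f ` I) = f i"
proof -
  have "Min (f ` I) \<in> f ` I" using assms by (intro Min_in) auto
  then show ?thesis by blast
qed

lemma inverse_Max_Min:
  fixes A :: "real set"
  assumes "finite A" "A \<noteq> {}" "\<And>x. x \<in> A \<Longrightarrow> 0 < x"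
  shows "Min (inverse ` A) = inverse (Max A)" "Max (inverse ` A) = inverse (Min A)"
proof -
  have Max: "Max A \<in> A" and Min: "Min A \<in> A" using assms by auto
  show "Min (inverse ` A) = inverse (Max A)"
    using assms Max by (intro Min_eqI) (auto intro!: le_imp_inverse_le)
  show "Max (inverse ` A) = inverse (Min A)"
    using assms(1) Min assms(3)[OF Min] by (intro Max_eqI) (auto intro!: le_imp_inverse_le)
qed

lemma Max_image_pos:
  fixes f :: "'e \<Rightarrow> real"
  assumes "p \<noteq> []" "\<And>e. e \<in> set p \<Longrightarrow> 0 < f e"
  shows "0 < Max (f ` set p)"
proof -
  have "Max (f ` set p) \<in> f ` set p" using assms(1) by (intro Max_in) auto
  then show ?thesis using assms(2) by auto
qed

lemma tendsto_path_norm_1: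
  assumes "(q \<longlongrightarrow> 1) F" "p \<noteq> []" "\<And>e. e \<in> set p \<Longrightarrow> 0 < mu e"
  shows "((\<lambda>t. path_norm mu (q t) p) \<longlongrightarrow> (\<Sum>e\<leftarrow>p. mu e)) F"
proof -
  have "((\<lambda>t. \<Sum>e\<leftarrow>p. mu e powr q t) \<longlongrightarrow> (\<Sum>e\<leftarrow>p. mu e)) F"
    using assms(3)
  proof (induction p)
    case (Cons e p)
    have "((\<lambda>t. mu e powr q t) \<longlongrightarrow> mu e powr 1) F"
      using Cons.prems[of e] assms(1) by (intro tendsto_powr tendsto_const) auto
    then show ?case using Cons by (auto intro!: tendsto_add simp: less_imp_le)
  qed simp
  moreover have "0 < (\<Sum>e\<leftarrow>p. mu e)"
    using assms(2,3)
  proof (induction p)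
    case (Cons e p)
    then show ?case by (cases p) (auto intro: add_pos_pos)
  qed simp
  moreover have "((\<lambda>t. 1 / q t) \<longlongrightarrow> 1 / 1) F"
    using assms(1) by (intro tendsto_divide tendsto_const) auto
  ultimately have "((\<lambda>t. path_norm mu (q t) p) \<longlongrightarrow> (\<Sum>e\<leftarrow>p. mu e) powr (1 / 1)) F"
    unfolding path_norm_def by (intro tendsto_powr) auto
  then show ?thesis using \<open>0 < (\<Sum>e\<leftarrow>p. mu e)\<close> by simp
qed

text \<open>The norm lies between the largest weight \<open>M\<close> and
  \<open>length p powr (1 / q) * M\<close>, whose factor tends to 1.\<close>

lemma tendsto_path_norm_at_top:
  assumes "filterlim q at_top F" "p \<noteq> []" "\<And>e. e \<in> set p \<Longrightarrow> 0 < mu e"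
  shows "((\<lambda>t. path_norm mu (q t) p) \<longlongrightarrow> Max (mu ` set p)) F"
proof -
  define M where "M = Max (mu ` set p)"
  have "M \<in> mu ` set p" using assms(2) unfolding M_def by (intro Max_in) auto
  then obtain e where e: "e \<in> set p" "M = mu e" by auto
  then have M: "0 < M" using assms(3) by simp
  have le_M: "mu e \<le> M" if "e \<in> set p" for e using that by (simp add: M_def)
  have lower: "M \<le> path_norm mu q p" if "0 < q" for q
  proof -
    have "M powr q \<le> (\<Sum>e\<leftarrow>p. mu e powr q)"
      using e by (intro member_le_sum_list) auto
    then have "(M powr q) powr (1 / q) \<le> path_norm mu q p"
      unfolding path_norm_def using that by (intro powr_mono2) auto
    then show ?thesis using that M by (simp add: powr_powr)
  qed
  have upper: "path_norm mu q p \<le> length p powr (1 / q) * M" if "0 < q" for q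
  proof -
    have "(\<Sum>e\<leftarrow>p. mu e powr q) \<le> (\<Sum>e\<leftarrow>p. M powr q)"
      using that le_M assms(3) by (intro sum_list_mono powr_mono2) (auto simp: less_imp_le)
    then have "(\<Sum>e\<leftarrow>p. mu e powr q) \<le> length p * M powr q"
      by (simp add: sum_list_triv)
    moreover have "0 \<le> (\<Sum>e\<leftarrow>p. mu e powr q)" by (intro sum_list_nonneg) auto
    ultimately have "path_norm mu q p \<le> (length p * M powr q) powr (1 / q)"
      unfolding path_norm_def using that by (intro powr_mono2) auto
    then show ?thesis using that M by (simp add: powr_powr powr_mult)
  qed
  have pos: "eventually (\<lambda>t. 0 < q t) F"
    using assms(1) by (simp add: filterlim_at_top_dense)
  have "((\<lambda>t. 1 / q t) \<longlongrightarrow> 0) F"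
    using assms(1) by (intro real_tendsto_divide_at_top) auto
  then have "((\<lambda>t. length p powr (1 / q t) * M) \<longlongrightarrow> length p powr 0 * M) F"
    using assms(2) by (intro tendsto_mult tendsto_powr tendsto_const) auto
  then have lim: "((\<lambda>t. length p powr (1 / q t) * M) \<longlongrightarrow> M) F" using assms(2) by simp
  show ?thesis
    unfolding M_def[symmetric]
    by (rule tendsto_sandwich[OF _ _ tendsto_const lim])
      (use pos lower upper in \<open>auto elim: eventually_mono\<close>)
qed

section \<open>Criteria for quasi-metrics, and the shortest and widest path limits\<close>

context fin_digraph
begin

text \<open>All four limits have this shape, so the conventions are settled here once: an
  unreachable leg makes the right-hand side infinite, and only distinct, successively reachable
  vertices remain.\<close>

lemma quasi_metric_onI:
  assumes d: "\<And>a b. a \<in> verts G \<Longrightarrow> b \<in> verts G \<Longrightarrow>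
      d a b = (if a = b then 0 else if a \<rightarrow>\<^sup>* b then ereal (D a b) else \<infinity>)"
    and pos: "\<And>a b. a \<rightarrow>\<^sup>* b \<Longrightarrow> a \<noteq> b \<Longrightarrow> 0 < D a b"
    and tri: "\<And>a b c. a \<rightarrow>\<^sup>* c \<Longrightarrow> c \<rightarrow>\<^sup>* b \<Longrightarrow> a \<noteq> b \<Longrightarrow> a \<noteq> c \<Longrightarrow> c \<noteq> b \<Longrightarrow> D a b \<le> D a c + D c b"
  shows "quasi_metric_on (verts G) d"
proof -
  have nonneg: "0 \<le> d a b" if "a \<in> verts G" "b \<in> verts G" for a b
    using that pos[of a b] by (auto simp: d less_imp_le)
  moreover have "d a b = 0 \<longleftrightarrow> a = b" if "a \<in> verts G" "b \<in> verts G" for a b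
    using that pos[of a b] by (auto simp: d)
  moreover have "d a b \<le> d a c + d c b"
    if v: "a \<in> verts G" "b \<in> verts G" "c \<in> verts G" for a b c
  proof -
    consider "a = b" | "c = a \<or> c = b" | "a \<noteq> b" "a \<noteq> c" "c \<noteq> b" "a \<rightarrow>\<^sup>* c" "c \<rightarrow>\<^sup>* b"
      | "a \<noteq> c" "\<not> a \<rightarrow>\<^sup>* c" | "c \<noteq> b" "\<not> c \<rightarrow>\<^sup>* b" by blast
    then show ?thesis
    proof cases
      case 1
      then show ?thesis using nonneg[of a c] nonneg[of c b] v by (simp add: d[of b b])
    next
      case 2
      then show ?thesis using v by (auto simp: d[of a a] d[of b b])
    next
      case 3
      then show ?thesis using v tri[of a c b] reachable_trans[of a c b] by (simp add: d)
    next
      case 4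
      then show ?thesis using nonneg[of c b] v by (simp add: d[of a c])
    next
      case 5
      then show ?thesis using nonneg[of a c] v by (simp add: d[of c b])
    qed
  qed
  ultimately show ?thesis by (simp add: quasi_metric_on_def)
qed

lemma quasi_ultrametric_onI:
  assumes d: "\<And>a b. a \<in> verts G \<Longrightarrow> b \<in> verts G \<Longrightarrow>
      d a b = (if a = b then 0 else if a \<rightarrow>\<^sup>* b then ereal (D a b) else \<infinity>)"
    and pos: "\<And>a b. a \<rightarrow>\<^sup>* b \<Longrightarrow> a \<noteq> b \<Longrightarrow> 0 < D a b"
    and max: "\<And>a b c. a \<rightarrow>\<^sup>* c \<Longrightarrow> c \<rightarrow>\<^sup>* b \<Longrightarrow> a \<noteq> b \<Longrightarrow> a \<noteq> c \<Longrightarrow> c \<noteq> b \<Longrightarrow> D a b \<le> max (D a c) (D c b)"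
  shows "quasi_ultrametric_on (verts G) d"
proof -
  have "D a b \<le> D a c + D c b"
    if "a \<rightarrow>\<^sup>* c" "c \<rightarrow>\<^sup>* b" "a \<noteq> b" "a \<noteq> c" "c \<noteq> b" for a b c
    using max[OF that] pos[OF that(1,4)] pos[OF that(2,5)] by simp
  with d pos have metric: "quasi_metric_on (verts G) d" by (rule quasi_metric_onI)
  have nonneg: "0 \<le> d a b" if "a \<in> verts G" "b \<in> verts G" for a b
    using that pos[of a b] by (auto simp: d less_imp_le)
  have "d a b \<le> max (d a c) (d c b)"
    if v: "a \<in> verts G" "b \<in> verts G" "c \<in> verts G" for a b c
  proof -
    consider "a = b" | "c = a \<or> c = b" | "a \<noteq> b" "a \<noteq> c" "c \<noteq> b" "a \<rightarrow>\<^sup>* c" "c \<rightarrow>\<^sup>* b"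
      | "a \<noteq> c" "\<not> a \<rightarrow>\<^sup>* c" | "c \<noteq> b" "\<not> c \<rightarrow>\<^sup>* b" by blast
    then show ?thesis
    proof cases
      case 1
      then show ?thesis using nonneg[of a c] nonneg[of c b] v by (simp add: d[of b b] le_max_iff_disj)
    next
      case 2
      then show ?thesis by (auto simp: le_max_iff_disj)
    next
      case 3
      then show ?thesis using v max[of a c b] reachable_trans[of a c b]
        by (simp add: d flip: ereal_max)
    next
      case 4
      then show ?thesis using v by (simp add: d[of a c])
    next
      case 5
      then show ?thesis using v by (simp add: d[of c b])
    qed
  qed
  then show ?thesis using metric by (simp add: quasi_ultrametric_on_def)
qed

lemma apaths_nonempty: "a \<rightarrow>\<^sup>* b \<Longrightarrow> {p. apath a p b} \<noteq> {}"
  using reachable_apath by auto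

lemma apath_arcs:
  assumes "apath a p b" "a \<noteq> b"
  shows "p \<noteq> []" "set p \<subseteq> arcs G"
  using assms by (auto simp: apath_def awalk_def)

text \<open>Inversion reverses the order and turns the maximum of minima of \<open>lam\<close> into
  the minimum of maxima of \<open>mu\<close>, the form in which the limit of the path norms
  arises.\<close>

lemma max_width_inverse:
  assumes ab: "a \<rightarrow>\<^sup>* b" "a \<noteq> b" and mu: "\<And>e. e \<in> arcs G \<Longrightarrow> 0 < mu e"
    and lam: "\<And>e. lam e = inverse (mu e)"
  shows "inverse (max_width G lam a b) = Min ((\<lambda>p. Max (mu ` set p)) ` {p. apath a p b})"
proof -
  let ?P = "{p. apath a p b}"
  have Min: "Min (lam ` set p) = inverse (Max (mu ` set p))" if "p \<in> ?P" for p
  proof -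
    have "lam ` set p = inverse ` mu ` set p" by (auto simp: lam image_image)
    moreover have "Min (inverse ` mu ` set p) = inverse (Max (mu ` set p))"
      by (rule inverse_Max_Min(1)) (use that apath_arcs[OF _ ab(2), of p] mu in auto)
    ultimately show ?thesis by simp
  qed
  have pos: "0 < Max (mu ` set p)" if "p \<in> ?P" for p
    by (rule Max_image_pos) (use that apath_arcs[OF _ ab(2), of p] mu in auto)
  have "(\<lambda>p. Min (lam ` set p)) ` ?P = inverse ` (\<lambda>p. Max (mu ` set p)) ` ?P"
    using Min by (auto simp: image_iff)
  moreover have "Max (inverse ` (\<lambda>p. Max (mu ` set p)) ` ?P)
      = inverse (Min ((\<lambda>p. Max (mu ` set p)) ` ?P))"
    by (rule inverse_Max_Min(2)) (use pos apaths_finite[of a b] apaths_nonempty[OF ab(1)] in auto)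
  ultimately show ?thesis by (simp add: max_width_def)
qed

text \<open>The largest weight on the concatenation of two optimal paths is the maximum of the two
  bottlenecks, and shortcutting it to a simple path only drops arcs.\<close>

lemma quasi_ultrametric_max_width:
  assumes mu: "\<And>e. e \<in> arcs G \<Longrightarrow> 0 < mu e" and lam: "\<And>e. lam e = inverse (mu e)"
  shows "quasi_ultrametric_on (verts G) (inverse_or_convention G (max_width G lam))"
proof (rule quasi_ultrametric_onI)
  let ?D = "\<lambda>a b. inverse (max_width G lam a b)"
  have eq: "?D a b = Min ((\<lambda>p. Max (mu ` set p)) ` {p. apath a p b})" if "a \<rightarrow>\<^sup>* b" "a \<noteq> b" for a b
    using that mu lam by (rule max_width_inverse)
  have pos: "0 < Max (mu ` set p)" if "apath a p b" "a \<noteq> b" for a b p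
    by (rule Max_image_pos) (use apath_arcs[OF that] mu in auto)
  show "inverse_or_convention G (max_width G lam) a b
      = (if a = b then 0 else if a \<rightarrow>\<^sup>* b then ereal (?D a b) else \<infinity>)" for a b
    by (simp add: inverse_or_convention_def)
  show "0 < ?D a b" if "a \<rightarrow>\<^sup>* b" "a \<noteq> b" for a b
    unfolding eq[OF that] using pos[OF _ that(2)] apaths_finite[of a b] apaths_nonempty[OF that(1)]
    by (subst Min_gr_iff) auto
  show "?D a b \<le> max (?D a c) (?D c b)"
    if r: "a \<rightarrow>\<^sup>* c" "c \<rightarrow>\<^sup>* b" and ne: "a \<noteq> b" "a \<noteq> c" "c \<noteq> b" for a b c
  proof -
    have ab: "a \<rightarrow>\<^sup>* b" using r by (rule reachable_trans)
    have attained: "\<exists>p. apath u p v \<and> ?D u v = Max (mu ` set p)" if "u \<rightarrow>\<^sup>* v" "u \<noteq> v" for u v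
      unfolding eq[OF that]
      using Min_image_attained[OF apaths_finite apaths_nonempty[OF that(1)]] by blast
    obtain p where p: "apath a p c" "?D a c = Max (mu ` set p)" using attained r ne by blast
    obtain q where q: "apath c q b" "?D c b = Max (mu ` set q)" using attained r ne by blast
    have walk: "awalk a (p @ q) b" using p q by (auto simp: apath_def)
    let ?w = "awalk_to_apath (p @ q)"
    have w: "apath a ?w b" using walk by (rule apath_awalk_to_apath)
    have "?D a b \<le> Max (mu ` set ?w)"
      unfolding eq[OF ab ne(1)] using apaths_finite[of a b] w by (intro Min_le) auto
    also have "\<dots> \<le> Max (mu ` set (p @ q))"
      using apath_arcs[OF w ne(1)] awalk_to_apath_subset[OF walk] by (intro Max_mono) auto
    also have "\<dots> = max (?D a c) (?D c b)"
      using apath_arcs[OF p(1) ne(2)] apath_arcs[OF q(1) ne(3)]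
      by (simp add: p(2) q(2) image_Un Max_Un)
    finally show ?thesis .
  qed
qed

lemma distance_eq:
  assumes mu: "\<And>e. e \<in> arcs G \<Longrightarrow> 0 < mu e" and "a \<in> verts G"
  shows "\<mu> mu a b = (if a = b then 0
    else if a \<rightarrow>\<^sup>* b then ereal (Min ((\<lambda>p. \<Sum>e\<leftarrow>p. mu e) ` {p. apath a p b})) else \<infinity>)"
proof -
  \<comment> \<open>For a vertex \<open>a\<close> the empty path is the only simple closed one, so
    the minimum agrees with the value 0 on the diagonal.\<close>
  have "{p. apath a p a} = {[]}"
    using assms(2) apath_nonempty_ends[of a _ a] by (auto simp: apath_Nil_iff)
  then show ?thesis
    using distance_eq_shortest_path_length[of G mu a b] fin_digraph_axioms mu assms(2)
    by (auto simp: less_imp_le)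
qed

lemma quasi_metric_distance:
  assumes mu: "\<And>e. e \<in> arcs G \<Longrightarrow> 0 < mu e"
  shows "quasi_metric_on (verts G) (\<mu> mu)"
proof (rule quasi_metric_onI)
  let ?D = "\<lambda>a b. Min ((\<lambda>p. \<Sum>e\<leftarrow>p. mu e) ` {p. apath a p b})"
  show "\<mu> mu a b = (if a = b then 0 else if a \<rightarrow>\<^sup>* b then ereal (?D a b) else \<infinity>)"
    if "a \<in> verts G" for a b
    by (rule distance_eq[OF mu that])
  show "0 < ?D a b" if "a \<rightarrow>\<^sup>* b" "a \<noteq> b" for a b
    using sum_list_pos_awalk[OF _ that(2) mu] apaths_finite[of a b] apaths_nonempty[OF that(1)]
    by (subst Min_gr_iff) (auto simp: apath_def)
  show "?D a b \<le> ?D a c + ?D c b"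
    if r: "a \<rightarrow>\<^sup>* c" "c \<rightarrow>\<^sup>* b" and ne: "a \<noteq> b" "a \<noteq> c" "c \<noteq> b" for a b c
  proof -
    have ab: "a \<rightarrow>\<^sup>* b" "a \<in> verts G" using r reachable_trans reachable_in_verts by auto
    have attained: "\<exists>p. apath u p v \<and> ?D u v = (\<Sum>e\<leftarrow>p. mu e)" if "u \<rightarrow>\<^sup>* v" for u v
      using Min_image_attained[OF apaths_finite apaths_nonempty[OF that]] by blast
    obtain p where p: "apath a p c" "?D a c = (\<Sum>e\<leftarrow>p. mu e)" using attained r by blast
    obtain q where q: "apath c q b" "?D c b = (\<Sum>e\<leftarrow>q. mu e)" using attained r by blast
    have cost: "awalk_cost mu p = (\<Sum>e\<leftarrow>p. mu e)" for p
      by (induction p) auto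
    have "awalk a (p @ q) b" using p q by (auto simp: apath_def)
    \<comment> \<open>The library distance ranges over all walks, so the concatenation is compared
      directly, without a shortcut.\<close>
    then have "\<mu> mu a b \<le> ereal (\<Sum>e\<leftarrow>p @ q. mu e)"
      unfolding cost[symmetric] by (rule min_cost_le_walk_cost)
    then show ?thesis using ab ne(1) p(2) q(2) by (simp add: distance_eq[OF mu])
  qed
qed

text \<open>The common part of cases 2 and 3: the resistance lies between
  \<open>?N powr (-1 / s t) * ?M t\<close> and \<open>?M t\<close>, and the factor tends to 1
  because \<open>s\<close> tends to infinity. Only the limit \<open>l\<close> of the path norms
  differs.\<close>

lemma tendsto_resistance_path_norm:
  fixes r s :: "real \<Rightarrow> real"
  assumes circuit: "\<And>t. 0 < t \<Longrightarrow> circuit G mu (r t) (s t)"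
    and s: "filterlim s at_top at_top" and ab: "a \<rightarrow>\<^sup>* b" "a \<noteq> b"
    and lim: "\<And>p. apath a p b \<Longrightarrow> ((\<lambda>t. path_norm mu (s t / r t) p) \<longlongrightarrow> l p) at_top"
  shows "((\<lambda>t. circuit.conductance G mu (r t) (s t) a b powr (-1 / s t))
     \<longlongrightarrow> Min (l ` {p. apath a p b})) at_top"
proof -
  let ?P = "{p. apath a p b}" and ?N = "real (card (arcs G))"
  let ?R = "\<lambda>t. circuit.conductance G mu (r t) (s t) a b powr (-1 / s t)"
  let ?M = "\<lambda>t. Min ((\<lambda>p. path_norm mu (s t / r t) p) ` ?P)"
  have P: "finite ?P" "?P \<noteq> {}" using apaths_finite apaths_nonempty[OF ab(1)] by auto
  then obtain p where "apath a p b" by auto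
  then have "arcs G \<noteq> {}" using apath_arcs[of a p b] ab(2) by auto
  then have N: "0 < ?N" by (simp add: card_gt_0_iff)
  have M: "(?M \<longlongrightarrow> Min (l ` ?P)) at_top"
    using P lim by (intro tendsto_Min_image) auto
  have "((\<lambda>t. - 1 / s t) \<longlongrightarrow> 0) at_top"
    using s by (intro real_tendsto_divide_at_top[where c = "-1"]) auto
  then have "((\<lambda>t. ?N powr (- 1 / s t) * ?M t) \<longlongrightarrow> ?N powr 0 * Min (l ` ?P)) at_top"
    using N by (intro tendsto_mult tendsto_powr tendsto_const M) auto
  then have lower: "((\<lambda>t. ?N powr (- 1 / s t) * ?M t) \<longlongrightarrow> Min (l ` ?P)) at_top"
    using \<open>arcs G \<noteq> {}\<close> by simp
  have "?N powr (- 1 / s t) * ?M t \<le> ?R t \<and> ?R t \<le> ?M t" if t: "0 < t" for t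
  proof -
    interpret circuit G mu "r t" "s t" using circuit[OF t] .
    obtain p where p: "apath a p b" "path_norm mu (s t / r t) p \<le> ?N powr (1 / s t) * ?R t"
      using path_norm_le_resistance[OF ab] by blast
    have "?M t \<le> path_norm mu (s t / r t) p" using P p(1) by (intro Min_le) auto
    then have "?M t \<le> ?N powr (1 / s t) * ?R t" using p(2) by simp
    then have "?N powr (- 1 / s t) * ?M t \<le> ?N powr (- 1 / s t) * (?N powr (1 / s t) * ?R t)"
      by (intro mult_left_mono) auto
    also have "\<dots> = ?R t"
      using \<open>arcs G \<noteq> {}\<close> by (simp add: mult.assoc[symmetric] flip: powr_add)
    finally have "?N powr (- 1 / s t) * ?M t \<le> ?R t" .
    moreover have "?R t \<le> ?M t"
      using P resistance_le_path_norm ab(2) by (intro Min.boundedI) (auto simp: apath_def)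
    ultimately show ?thesis by simp
  qed
  then have "eventually (\<lambda>t. ?N powr (- 1 / s t) * ?M t \<le> ?R t \<and> ?R t \<le> ?M t) at_top"
    using eventually_gt_at_top[of "0::real"] by (rule eventually_mono[rotated])
  then show ?thesis
    by (intro tendsto_sandwich[OF _ _ lower M]) (auto elim: eventually_mono)
qed

lemma tendsto_effective_resistance:
  fixes r s :: "real \<Rightarrow> real"
  assumes circuit: "\<And>t. 0 < t \<Longrightarrow> circuit G mu (r t) (s t)"
    and lim: "a \<rightarrow>\<^sup>* b \<Longrightarrow> a \<noteq> b \<Longrightarrow>
      ((\<lambda>t. circuit.conductance G mu (r t) (s t) a b powr (-1 / s t)) \<longlongrightarrow> D) at_top"
  shows "((\<lambda>t. effective_resistance G mu (r t) (s t) a b) \<longlongrightarrow>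
    (if a = b then 0 else if a \<rightarrow>\<^sup>* b then ereal D else \<infinity>)) at_top"
proof (cases "a \<noteq> b \<and> a \<rightarrow>\<^sup>* b")
  case True
  have "eventually (\<lambda>t. effective_resistance G mu (r t) (s t) a b
      = ereal (circuit.conductance G mu (r t) (s t) a b powr (-1 / s t))) at_top"
    using eventually_gt_at_top[of "0::real"]
  proof (rule eventually_mono)
    fix t :: real assume "0 < t"
    then show "effective_resistance G mu (r t) (s t) a b
        = ereal (circuit.conductance G mu (r t) (s t) a b powr (-1 / s t))"
      using True circuit.effective_resistance_eq[OF circuit, of t a b] by simp
  qed
  then show ?thesis using True lim by (simp add: tendsto_cong)
next
  case False
  then show ?thesis by (auto simp: effective_resistance_def)
qed

end

section \<open>Maximal flows\<close>

context circuit
begin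

text \<open>Unit potentials make every voltage at most 1, so the currents respect these capacities
  whatever \<open>r\<close> is.\<close>

lemma conductance_le_max_flow:
  assumes ab: "a \<in> verts G" "b \<in> verts G" "a \<noteq> b"
  shows "conductance a b \<le> max_flow G (\<lambda>e. 1 / mu e powr s) a b"
proof -
  obtain x where x: "unit_solution a b x" using unit_solution_exists[OF ab] by blast
  have "current G mu r s x e \<le> 1 / mu e powr s" if e: "e \<in> arcs G" for e
  proof -
    have "tail G e \<in> verts G" "head G e \<in> verts G" using e by auto
    then have "0 \<le> x (head G e)" "x (tail G e) \<le> 1" using x by (auto simp: unit_solution_def)
    then have "voltage G x e \<le> 1" by (simp add: voltage_def)
    then have "max 0 (voltage G x e) powr r \<le> 1 powr r"
      using r_pos by (intro powr_mono2) auto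
    then show ?thesis by (simp add: current_eq divide_right_mono)
  qed
  then have "is_flow G (\<lambda>e. 1 / mu e powr s) a b (current G mu r s x)"
    using x current_nonneg by (auto simp: is_flow_def unit_solution_def flux_def)
  moreover have "net_outflow G (current G mu r s x) a = conductance a b"
    using flux_unit_solution[OF x ab(1)] by (simp add: flux_def)
  ultimately show ?thesis using flow_le_max_flow[of "\<lambda>e. 1 / mu e powr s"] by fastforce
qed

text \<open>Among the intervals \<open>{(k - 1) / n<..k / n}\<close>, where \<open>n\<close> counts the vertices, one contains
  no potential, as \<open>b\<close> has potential \<open>0\<close>. Arcs leaving the corresponding level set carry
  nearly their capacity when \<open>r\<close> is small.\<close>

lemma cut_le_conductance:
  assumes ab: "a \<in> verts G" "b \<in> verts G" "a \<noteq> b"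
  obtains S where "S \<subseteq> verts G" "a \<in> S" "b \<notin> S"
    and "card (verts G) powr (- r) * cut_value (\<lambda>e. 1 / mu e powr s) S \<le> conductance a b"
proof -
  obtain x where x: "unit_solution a b x" using unit_solution_exists[OF ab] by blast
  define n where "n = card (verts G)"
  have n: "0 < n" unfolding n_def using ab by (auto simp: card_gt_0_iff)
  \<comment> \<open>\<open>level v = k\<close> says exactly that \<open>x v\<close> lies in
    \<open>{(k - 1) / n<..k / n}\<close>.\<close>
  define level where "level v = \<lceil>real n * x v\<rceil>" for v
  \<comment> \<open>Otherwise the \<open>n\<close> vertices would realise \<open>n + 1\<close>
    levels, since \<open>b\<close> has level 0.\<close>
  have "\<not> {1..int n} \<subseteq> level ` verts G"
  proof
    assume "{1..int n} \<subseteq> level ` verts G"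
    moreover have "0 \<in> level ` verts G"
      using x ab by (intro image_eqI[of _ _ b]) (auto simp: level_def unit_solution_def)
    ultimately have "{0..int n} \<subseteq> level ` verts G"
      by (auto simp: subset_iff) (metis atLeastAtMost_iff image_eqI le_less zless_imp_add1_zle add_0)
    then have "card {0..int n} \<le> card (level ` verts G)" by (intro card_mono) auto
    also have "\<dots> \<le> n" unfolding n_def by (rule card_image_le) simp
    finally show False by simp
  qed
  then obtain k where "k \<in> {1..int n}" "k \<notin> level ` verts G" by blast
  then have k: "1 \<le> k" "k \<le> int n" "\<And>v. v \<in> verts G \<Longrightarrow> level v \<noteq> k" by auto
  define c where "c = real_of_int k / n"
  have c: "0 < c" "c \<le> 1" using k n by (auto simp: c_def divide_simps)
  let ?S = "{v \<in> verts G. c \<le> x v}"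
  have gap: "x v \<le> c - 1 / n" if v: "v \<in> verts G" "x v < c" for v
  proof -
    have "real n * x v < k" using v n by (simp add: c_def field_simps)
    then have "level v \<le> k" by (simp add: level_def ceiling_le_iff)
    then have "level v \<le> k - 1" using k(3)[OF v(1)] by simp
    then have "real n * x v \<le> real_of_int (k - 1)" by (simp only: level_def ceiling_le_iff)
    then show ?thesis using n by (simp add: c_def field_simps)
  qed
  \<comment> \<open>An arc leaving the level set jumps over the empty interval, so its voltage is at
    least \<open>1 / n\<close>.\<close>
  have arc: "n powr (- r) * (1 / mu e powr s) \<le> current G mu r s x e"
    if e: "e \<in> arcs G" "tail G e \<in> ?S" "head G e \<notin> ?S" for e
  proof -
    have "1 / n \<le> voltage G x e"
      using e gap[of "head G e"] by (auto simp: voltage_def)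
    moreover have "0 < 1 / real n" using n by simp
    ultimately have "0 \<le> voltage G x e" "(1 / n) powr r \<le> voltage G x e powr r"
      using r_pos by (linarith, intro powr_mono2) auto
    then have "(1 / n) powr r / mu e powr s \<le> current G mu r s x e"
      by (simp add: current_def divide_right_mono)
    then show ?thesis using n by (simp add: powr_divide powr_minus_divide)
  qed
  show thesis
  proof (rule that[of ?S])
    show "?S \<subseteq> verts G" "a \<in> ?S" "b \<notin> ?S"
      using x ab c by (auto simp: unit_solution_def)
    have "n powr (- r) * cut_value (\<lambda>e. 1 / mu e powr s) ?S \<le> cut_value (current G mu r s x) ?S"
      unfolding cut_value_cmult[symmetric] unfolding cut_value_def by (intro sum_mono arc) auto
    then show "card (verts G) powr (- r) * cut_value (\<lambda>e. 1 / mu e powr s) ?S \<le> conductance a b"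
      unfolding n_def conductance_eq_level_cut[OF x ab(1) c] .
  qed
qed

end

section \<open>Flow-cut duality and the limit of vanishing \<open>r\<close>\<close>

context fin_digraph
begin

text \<open>Letting \<open>r\<close> tend to \<open>0\<close> in the circuits with \<open>s = 1\<close> proves that a minimal cut does not
  exceed the maximal flow.\<close>

lemma max_flow_ge_cut:
  assumes mu: "\<And>e. e \<in> arcs G \<Longrightarrow> 0 < mu e" and lam: "\<And>e. lam e = inverse (mu e)"
    and ab: "a \<in> verts G" "b \<in> verts G" "a \<noteq> b"
  obtains S where "S \<subseteq> verts G" "a \<in> S" "b \<notin> S" "cut_value lam S \<le> max_flow G lam a b"
proof -
  define cuts where "cuts = {S. S \<subseteq> verts G \<and> a \<in> S \<and> b \<notin> S}"
  have fin: "finite cuts" by (rule finite_subset[of _ "Pow (verts G)"]) (auto simp: cuts_def)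
  have ne: "cuts \<noteq> {}" using ab by (auto simp: cuts_def intro!: exI[of _ "{a}"])
  \<comment> \<open>The cut supplied by the circuit depends on \<open>r\<close>; the minimal cut
    value \<open>K\<close> does not, so \<open>r\<close> can tend to 0 with \<open>K\<close>
    fixed.\<close>
  define K where "K = Min (cut_value lam ` cuts)"
  let ?n = "real (card (verts G))"
  have n: "0 < ?n" using ab by (auto simp: card_gt_0_iff)
  have "?n powr (- r) * K \<le> max_flow G lam a b" if r: "0 < r" for r
  proof -
    interpret circuit G mu r 1 using mu r by unfold_locales auto
    obtain S where S: "S \<subseteq> verts G" "a \<in> S" "b \<notin> S"
      "?n powr (- r) * cut_value (\<lambda>e. 1 / mu e powr 1) S \<le> conductance a b"
      using cut_le_conductance[OF ab] by blast
    have cap: "1 / mu e powr 1 = lam e" if "e \<in> arcs G" for e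
      using mu[OF that] by (simp add: lam inverse_eq_divide)
    have cut: "cut_value (\<lambda>e. 1 / mu e powr 1) S = cut_value lam S"
      unfolding cut_value_def by (intro sum.cong refl cap) simp
    have flow: "max_flow G (\<lambda>e. 1 / mu e powr 1) a b = max_flow G lam a b"
      using cap by (simp add: max_flow_def is_flow_def cong: ball_cong)
    have "K \<le> cut_value lam S"
      unfolding K_def using fin S by (intro Min_le) (auto simp: cuts_def)
    then have "?n powr (- r) * K \<le> ?n powr (- r) * cut_value lam S"
      by (intro mult_left_mono) auto
    then show ?thesis using S(4) conductance_le_max_flow[OF ab] unfolding cut flow by linarith
  qed
  then have "eventually (\<lambda>r. ?n powr (- r) * K \<le> max_flow G lam a b) (at_right 0)"
    by (auto simp: eventually_at_filter)
  moreover have "((\<lambda>r. ?n powr (- r) * K) \<longlongrightarrow> ?n powr (- 0) * K) (at_right 0)"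
    using n by (intro tendsto_mult tendsto_powr tendsto_minus tendsto_const tendsto_ident_at) auto
  ultimately have "?n powr (- 0) * K \<le> max_flow G lam a b"
    by (intro tendsto_upperbound) auto
  then have "K \<le> max_flow G lam a b" using ab by (auto split: if_splits)
  moreover obtain S where "S \<in> cuts" "K = cut_value lam S"
    unfolding K_def using Min_image_attained[OF fin ne] by blast
  ultimately show thesis using that by (auto simp: cuts_def)
qed

lemma max_flow_le_cut:
  assumes "\<And>e. e \<in> arcs G \<Longrightarrow> 0 \<le> cap e" "S \<subseteq> verts G" "a \<in> S" "b \<notin> S"
  shows "max_flow G cap a b \<le> cut_value cap S"
proof -
  obtain f where "is_flow G cap a b f" "net_outflow G f a = max_flow G cap a b"
    using max_flow_attained[of cap a b] assms(1) by blast
  then show ?thesis using flow_le_cut[OF _ assms(2-4)] by metis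
qed

text \<open>Dividing a maximal flow for \<open>cap'\<close> by \<open>k\<close> gives a flow for
  \<open>cap\<close>. This controls the effect of perturbed capacities.\<close>

lemma max_flow_scale:
  assumes cap: "\<And>e. e \<in> arcs G \<Longrightarrow> 0 \<le> cap e" "\<And>e. e \<in> arcs G \<Longrightarrow> 0 \<le> cap' e"
    and k: "0 < k" "\<And>e. e \<in> arcs G \<Longrightarrow> cap' e \<le> k * cap e"
  shows "max_flow G cap' a b \<le> k * max_flow G cap a b"
proof -
  obtain f where f: "is_flow G cap' a b f" "net_outflow G f a = max_flow G cap' a b"
    using max_flow_attained[of cap' a b] cap(2) by blast
  have net: "net_outflow G (\<lambda>e. f e / k) v = net_outflow G f v / k" for v
    by (simp add: net_outflow_def sum_divide_distrib diff_divide_distrib)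
  have "f e / k \<le> cap e" if "e \<in> arcs G" for e
  proof -
    have "f e \<le> k * cap e" using f(1) k(2)[OF that] that by (force simp: is_flow_def)
    then show ?thesis using k(1) by (simp add: field_simps)
  qed
  then have "is_flow G cap a b (\<lambda>e. f e / k)"
    using f k(1) by (auto simp: is_flow_def net)
  then have "net_outflow G f a / k \<le> max_flow G cap a b"
    using flow_le_max_flow[OF cap(1), where f = "\<lambda>e. f e / k"] by (simp add: net)
  then show ?thesis using f k(1) by (simp add: field_simps)
qed

lemma max_flow_pos:
  assumes mu: "\<And>e. e \<in> arcs G \<Longrightarrow> 0 < mu e" and lam: "\<And>e. lam e = inverse (mu e)"
    and ab: "a \<rightarrow>\<^sup>* b" "a \<noteq> b"
  shows "0 < max_flow G lam a b"
proof -
  interpret circuit G mu 1 1 using mu by unfold_locales auto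
  have verts: "a \<in> verts G" "b \<in> verts G" using ab reachable_in_verts by auto
  have "0 < max_flow G (\<lambda>e. 1 / mu e powr 1) a b"
    using conductance_pos[OF ab] conductance_le_max_flow[OF verts ab(2)] by linarith
  also have "\<dots> \<le> 1 * max_flow G lam a b"
    using mu by (intro max_flow_scale) (auto simp: lam inverse_eq_divide less_imp_le)
  finally show ?thesis by simp
qed

text \<open>A minimal cut between \<open>a\<close> and \<open>b\<close> also separates
  \<open>c\<close> from \<open>b\<close> or \<open>a\<close> from \<open>c\<close>, depending on the
  side of \<open>c\<close>. It bounds the corresponding maximal flow.\<close>

lemma quasi_ultrametric_max_flow:
  assumes mu: "\<And>e. e \<in> arcs G \<Longrightarrow> 0 < mu e" and lam: "\<And>e. lam e = inverse (mu e)"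
  shows "quasi_ultrametric_on (verts G) (inverse_or_convention G (max_flow G lam))"
proof (rule quasi_ultrametric_onI)
  let ?D = "\<lambda>a b. inverse (max_flow G lam a b)"
  have pos: "0 < max_flow G lam a b" if "a \<rightarrow>\<^sup>* b" "a \<noteq> b" for a b
    using mu lam that by (rule max_flow_pos)
  show "inverse_or_convention G (max_flow G lam) a b
      = (if a = b then 0 else if a \<rightarrow>\<^sup>* b then ereal (?D a b) else \<infinity>)" for a b
    by (simp add: inverse_or_convention_def)
  show "0 < ?D a b" if "a \<rightarrow>\<^sup>* b" "a \<noteq> b" for a b
    using pos[OF that] by simp
  show "?D a b \<le> max (?D a c) (?D c b)"
    if r: "a \<rightarrow>\<^sup>* c" "c \<rightarrow>\<^sup>* b" and ne: "a \<noteq> b" "a \<noteq> c" "c \<noteq> b" for a b c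
  proof -
    have verts: "a \<in> verts G" "b \<in> verts G" using r reachable_in_verts by auto
    have nonneg: "0 \<le> lam e" if "e \<in> arcs G" for e using mu[OF that] by (simp add: lam)
    obtain S where S: "S \<subseteq> verts G" "a \<in> S" "b \<notin> S" "cut_value lam S \<le> max_flow G lam a b"
      using mu lam verts ne(1) by (rule max_flow_ge_cut)
    show ?thesis
    proof (cases "c \<in> S")
      case True
      then have "max_flow G lam c b \<le> max_flow G lam a b"
        using max_flow_le_cut[of lam S c b] nonneg S by force
      then have "?D a b \<le> ?D c b" using pos[OF r(2) ne(3)] by (rule le_imp_inverse_le)
      then show ?thesis by simp
    next
      case False
      then have "max_flow G lam a c \<le> max_flow G lam a b"
        using max_flow_le_cut[of lam S a c] nonneg S by force
      then have "?D a b \<le> ?D a c" using pos[OF r(1) ne(2)] by (rule le_imp_inverse_le)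
      then show ?thesis by simp
    qed
  qed
qed

lemma tendsto_resistance_max_flow:
  fixes r s :: "real \<Rightarrow> real"
  assumes circuit: "\<And>t. 0 < t \<Longrightarrow> circuit G mu (r t) (s t)"
    and mu: "\<And>e. e \<in> arcs G \<Longrightarrow> 0 < mu e" and lam: "\<And>e. lam e = inverse (mu e)"
    and s: "(s \<longlongrightarrow> 1) at_top" and r: "(r \<longlongrightarrow> 0) at_top" and ab: "a \<rightarrow>\<^sup>* b" "a \<noteq> b"
  shows "((\<lambda>t. circuit.conductance G mu (r t) (s t) a b powr (-1 / s t))
     \<longlongrightarrow> inverse (max_flow G lam a b)) at_top"
proof -
  let ?C = "\<lambda>t. circuit.conductance G mu (r t) (s t) a b" and ?L = "max_flow G lam a b"
  let ?n = "real (card (verts G))"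
  \<comment> \<open>The capacity \<open>1 / mu e powr s t\<close> is
    \<open>mu e powr (1 - s t)\<close> times \<open>lam e\<close>; \<open>\<kappa> t\<close> bounds
    the relative error of all arcs at once.\<close>
  define \<kappa> where "\<kappa> t = (\<Sum>e\<in>arcs G. \<bar>mu e powr (1 - s t) - 1\<bar>)" for t
  have verts: "a \<in> verts G" "b \<in> verts G" using ab reachable_in_verts by auto
  have L: "0 < ?L" using mu lam ab by (rule max_flow_pos)
  have n: "verts G \<noteq> {}" using verts by auto
  have pow: "1 / mu e powr s t = mu e powr (1 - s t) * lam e" if "e \<in> arcs G" for e t
    using mu[OF that] by (simp add: lam powr_diff inverse_eq_divide)
  have \<kappa>: "\<bar>mu e powr (1 - s t) - 1\<bar> \<le> \<kappa> t" if "e \<in> arcs G" for e t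
    unfolding \<kappa>_def using that by (intro member_le_sum) auto
  have lam_nonneg: "0 \<le> lam e" if "e \<in> arcs G" for e using mu[OF that] by (simp add: lam)
  have \<kappa>_nonneg: "0 \<le> \<kappa> t" for t unfolding \<kappa>_def by (intro sum_nonneg) auto
  have upper: "?C t \<le> (1 + \<kappa> t) * ?L" if t: "0 < t" for t
  proof -
    interpret circuit G mu "r t" "s t" using circuit[OF t] .
    have "1 / mu e powr s t \<le> (1 + \<kappa> t) * lam e" if "e \<in> arcs G" for e
      unfolding pow[OF that] using \<kappa>[OF that, of t] lam_nonneg[OF that]
      by (intro mult_right_mono) auto
    then have "max_flow G (\<lambda>e. 1 / mu e powr s t) a b \<le> (1 + \<kappa> t) * ?L"
      using lam_nonneg \<kappa>_nonneg[of t] by (intro max_flow_scale) auto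
    then show ?thesis using conductance_le_max_flow[OF verts ab(2)] by simp
  qed
  have lower: "?n powr (- r t) * ((1 - \<kappa> t) * ?L) \<le> ?C t" if t: "0 < t" "\<kappa> t < 1" for t
  proof -
    interpret circuit G mu "r t" "s t" using circuit[OF t(1)] .
    obtain S where S: "S \<subseteq> verts G" "a \<in> S" "b \<notin> S"
      "?n powr (- r t) * cut_value (\<lambda>e. 1 / mu e powr s t) S \<le> conductance a b"
      using cut_le_conductance[OF verts ab(2)] by blast
    have "(1 - \<kappa> t) * ?L \<le> (1 - \<kappa> t) * cut_value lam S"
      using max_flow_le_cut[OF lam_nonneg S(1-3)] t by (intro mult_left_mono) auto
    also have "\<dots> \<le> cut_value (\<lambda>e. 1 / mu e powr s t) S"
      unfolding cut_value_cmult[symmetric]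
    proof (rule cut_value_mono)
      fix e assume e: "e \<in> arcs G"
      show "(1 - \<kappa> t) * lam e \<le> 1 / mu e powr s t"
        unfolding pow[OF e] using \<kappa>[OF e, of t] lam_nonneg[OF e]
        by (intro mult_right_mono) auto
    qed
    finally have "?n powr (- r t) * ((1 - \<kappa> t) * ?L)
        \<le> ?n powr (- r t) * cut_value (\<lambda>e. 1 / mu e powr s t) S"
      by (intro mult_left_mono) auto
    then show ?thesis using S(4) by linarith
  qed
  have pow_lim: "((\<lambda>t. mu e powr (1 - s t)) \<longlongrightarrow> mu e powr (1 - 1)) at_top" if "e \<in> arcs G" for e
    using mu[OF that] by (intro tendsto_powr tendsto_diff tendsto_const s) auto
  have "(\<kappa> \<longlongrightarrow> (\<Sum>e\<in>arcs G. \<bar>mu e powr (1 - 1) - 1\<bar>)) at_top"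
    unfolding \<kappa>_def by (intro tendsto_sum tendsto_rabs tendsto_diff tendsto_const pow_lim)
  also have "(\<Sum>e\<in>arcs G. \<bar>mu e powr (1 - 1) - 1\<bar>) = 0"
    using mu by (intro sum.neutral) fastforce
  finally have \<kappa>_0: "(\<kappa> \<longlongrightarrow> 0) at_top" .
  have "((\<lambda>t. (1 + \<kappa> t) * ?L) \<longlongrightarrow> (1 + 0) * ?L) at_top"
    by (intro tendsto_intros \<kappa>_0)
  then have lim_upper: "((\<lambda>t. (1 + \<kappa> t) * ?L) \<longlongrightarrow> ?L) at_top" by simp
  have "((\<lambda>t. ?n powr (- r t) * ((1 - \<kappa> t) * ?L)) \<longlongrightarrow> ?n powr (- 0) * ((1 - 0) * ?L)) at_top"
    using n by (intro tendsto_mult tendsto_powr tendsto_minus tendsto_diff tendsto_const \<kappa>_0 r) auto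
  then have lim_lower: "((\<lambda>t. ?n powr (- r t) * ((1 - \<kappa> t) * ?L)) \<longlongrightarrow> ?L) at_top"
    using n by simp
  have pos: "eventually (\<lambda>t::real. 0 < t) at_top" by (rule eventually_gt_at_top)
  moreover have "eventually (\<lambda>t. \<kappa> t < 1) at_top" using order_tendstoD(2)[OF \<kappa>_0] by simp
  ultimately have ev_lower: "eventually (\<lambda>t. ?n powr (- r t) * ((1 - \<kappa> t) * ?L) \<le> ?C t) at_top"
    by eventually_elim (rule lower)
  have ev_upper: "eventually (\<lambda>t. ?C t \<le> (1 + \<kappa> t) * ?L) at_top"
    using pos by eventually_elim (rule upper)
  have "(?C \<longlongrightarrow> ?L) at_top"
    using ev_lower ev_upper lim_lower lim_upper by (rule tendsto_sandwich)
  then have "((\<lambda>t. ?C t powr (-1 / s t)) \<longlongrightarrow> ?L powr (-1 / 1)) at_top"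
    using L by (intro tendsto_powr tendsto_divide tendsto_const s) auto
  then show ?thesis using L by (simp add: powr_minus)
qed

end

section \<open>Ohm's law\<close>

text \<open>Lipschitz continuity in the exponent, uniformly in the base: the derivative is
  controlled by \<open>y powr p * - ln y\<close>, which is at most \<open>1 / p\<close>, and the
  lower bound on \<open>p\<close> turns this into the constant 2.\<close>

lemma powr_diff_le:
  fixes y :: real
  assumes y: "0 \<le> y" "y \<le> 1" and pq: "1 / 2 \<le> p" "p \<le> q"
  shows "y powr q \<le> y powr p" "y powr p - y powr q \<le> 2 * (q - p)"
proof -
  show "y powr q \<le> y powr p" using assms by (intro powr_mono') auto
  show "y powr p - y powr q \<le> 2 * (q - p)"
  proof (cases "y = 0")
    case False
    then have y0: "0 < y" using y by simp
    have "y powr p * - ln y \<le> 1 / p"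
    proof -
      have "ln (1 / y) \<le> (1 / y) powr p / p"
        using y0 y pq by (intro ln_powr_bound) auto
      then show ?thesis using y0 pq by (simp add: ln_div powr_divide field_simps)
    qed
    also have "1 / p \<le> 2" using pq by (simp add: field_simps)
    finally have ln: "y powr p * - ln y \<le> 2" .
    have "1 + (q - p) * ln y \<le> y powr (q - p)"
      using y0 by (simp add: powr_def exp_ge_add_one_self)
    then have "1 - y powr (q - p) \<le> (q - p) * - ln y" by simp
    have "y powr p - y powr q = y powr p * (1 - y powr (q - p))"
      using y0 by (simp add: right_diff_distrib flip: powr_add)
    also have "\<dots> \<le> y powr p * ((q - p) * - ln y)"
      using \<open>1 - y powr (q - p) \<le> (q - p) * - ln y\<close> by (intro mult_left_mono) auto
    also have "\<dots> = (q - p) * (y powr p * - ln y)" by simp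
    also have "\<dots> \<le> (q - p) * 2" using ln pq by (intro mult_left_mono) auto
    finally show ?thesis by simp
  qed (use pq in simp)
qed

text \<open>The first summand accounts for changing \<open>s\<close> to 1, the second for changing
  \<open>r\<close> to 1 by the Lipschitz constant 2.\<close>

definition current_error :: "real \<Rightarrow> real \<Rightarrow> real \<Rightarrow> real" where
  "current_error m r s = \<bar>1 / m powr s - 1 / m\<bar> + 2 * \<bar>r - 1\<bar> / m"

section \<open>Perturbation of Ohm's law\<close>

context circuit
begin

lemma current_diff_le:
  assumes e: "e \<in> arcs G" and v: "voltage G x e \<le> 1" and r: "1 / 2 \<le> r"
  shows "\<bar>current G mu r s x e - current G mu 1 1 x e\<bar> \<le> current_error (mu e) r s"
proof -
  define y where "y = max 0 (voltage G x e)"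
  have y: "0 \<le> y" "y \<le> 1" using v by (auto simp: y_def)
  have mu: "0 < mu e" using mu_pos[OF e] .
  interpret ohm: circuit G mu 1 1 using mu_pos by unfold_locales auto
  have 1: "current G mu 1 1 x e = y / mu e"
    using mu y by (simp add: ohm.current_eq flip: y_def)
  have "current G mu r s x e - current G mu 1 1 x e
      = y powr r * (1 / mu e powr s - 1 / mu e) + (y powr r - y) / mu e"
    unfolding 1 by (simp add: current_eq right_diff_distrib diff_divide_distrib flip: y_def)
  also have "\<bar>\<dots>\<bar> \<le> \<bar>y powr r * (1 / mu e powr s - 1 / mu e)\<bar> + \<bar>(y powr r - y) / mu e\<bar>"
    by (rule abs_triangle_ineq)
  also have "\<dots> = y powr r * \<bar>1 / mu e powr s - 1 / mu e\<bar> + \<bar>y powr r - y\<bar> / mu e"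
    using mu by (simp add: abs_mult)
  also have "\<dots> \<le> 1 * \<bar>1 / mu e powr s - 1 / mu e\<bar> + 2 * \<bar>r - 1\<bar> / mu e"
  proof (intro add_mono mult_right_mono divide_right_mono)
    show "y powr r \<le> 1" using y r_pos powr_mono2[of r y 1] by simp
    show "\<bar>y powr r - y\<bar> \<le> 2 * \<bar>r - 1\<bar>"
      using powr_diff_le[of y r 1] powr_diff_le[of y 1 r] y r by (cases "r \<le> 1") auto
  qed (use mu in auto)
  finally show ?thesis by (simp add: current_error_def)
qed

text \<open>Both solutions have the same boundary values, so \<open>\<Sum>e. (y e - z e) * (y* e - z* e) = 0\<close>
  for their voltages \<open>y, z\<close> and currents \<open>y*, z*\<close>. Since the Ohm current law is
  monotone, replacing \<open>y*\<close> by the nearby Ohm current of \<open>y\<close> bounds the difference of the currents.\<close>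

lemma conductance_diff_Ohm_le:
  assumes ab: "a \<in> verts G" "b \<in> verts G" "a \<noteq> b" and r: "1 / 2 \<le> r"
  defines "H \<equiv> \<Sum>e\<in>arcs G. current_error (mu e) r s"
  shows "\<bar>conductance a b - circuit.conductance G mu 1 1 a b\<bar>
    \<le> 2 * (\<Sum>e\<in>arcs G. current_error (mu e) r s + sqrt (2 * H / mu e))"
proof -
  interpret ohm: circuit G mu 1 1 using mu_pos by unfold_locales auto
  obtain x where x: "unit_solution a b x" using unit_solution_exists[OF ab] by blast
  obtain z where z: "ohm.unit_solution a b z" using ohm.unit_solution_exists[OF ab] by blast
  \<comment> \<open>\<open>?g\<close> is the Ohm current of the potentials \<open>x\<close>, between
    the given current \<open>?f\<close> and the true Ohm current \<open>?h\<close>. The two summands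
    of \<open>B\<close> bound the two distances.\<close>
  let ?f = "current G mu r s x" and ?g = "current G mu 1 1 x" and ?h = "current G mu 1 1 z"
  define B where "B e = current_error (mu e) r s + sqrt (2 * H / mu e)" for e
  have err_nonneg: "0 \<le> current_error (mu e) r s" if "e \<in> arcs G" for e
    using mu_pos[OF that] by (simp add: current_error_def)
  have volt: "\<bar>voltage G x e\<bar> \<le> 1" "\<bar>voltage G z e\<bar> \<le> 1" if e: "e \<in> arcs G" for e
  proof -
    have "tail G e \<in> verts G" "head G e \<in> verts G" using e by auto
    then have "0 \<le> x (tail G e)" "x (tail G e) \<le> 1" "0 \<le> x (head G e)" "x (head G e) \<le> 1"
        "0 \<le> z (tail G e)" "z (tail G e) \<le> 1" "0 \<le> z (head G e)" "z (head G e) \<le> 1"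
      using x z by (auto simp: unit_solution_def ohm.unit_solution_def)
    then show "\<bar>voltage G x e\<bar> \<le> 1" "\<bar>voltage G z e\<bar> \<le> 1" by (auto simp: voltage_def)
  qed
  have fg: "\<bar>?f e - ?g e\<bar> \<le> current_error (mu e) r s" if e: "e \<in> arcs G" for e
    using volt(1)[OF e] by (intro current_diff_le[OF e _ r]) simp
  let ?d = "\<lambda>e. voltage G x e - voltage G z e"
  \<comment> \<open>Taking positive parts is monotone and 1-Lipschitz, hence
    \<open>(X - Z)\<^sup>2 \<le> ?d e * (X - Z)\<close>. This strong monotonicity makes the
    difference of currents appear squared.\<close>
  have mono: "mu e * (?g e - ?h e)\<^sup>2 \<le> ?d e * (?g e - ?h e)" if e: "e \<in> arcs G" for e
  proof -
    define X Z where "X = max 0 (voltage G x e)" and "Z = max 0 (voltage G z e)"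
    have mu: "0 < mu e" using mu_pos[OF e] .
    have gh: "?g e - ?h e = (X - Z) / mu e"
      using mu by (simp add: ohm.current_eq X_def Z_def diff_divide_distrib)
    have "(X - Z)\<^sup>2 \<le> ?d e * (X - Z)"
    proof (cases "voltage G z e \<le> voltage G x e")
      case True
      then have "X - Z \<le> ?d e" "0 \<le> X - Z" by (auto simp: X_def Z_def)
      then show ?thesis by (simp add: power2_eq_square mult_right_mono)
    next
      case False
      then have "?d e \<le> X - Z" "X - Z \<le> 0" by (auto simp: X_def Z_def)
      then show ?thesis by (simp add: power2_eq_square mult_right_mono_neg)
    qed
    then have "(X - Z)\<^sup>2 / mu e \<le> ?d e * (X - Z) / mu e"
      using mu by (intro divide_right_mono) auto
    moreover have "mu e * ((X - Z) / mu e)\<^sup>2 = (X - Z)\<^sup>2 / mu e"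
      using mu by (simp add: power2_eq_square)
    ultimately show ?thesis unfolding gh by simp
  qed
  have "(\<Sum>e\<in>arcs G. ?d e * (?f e - ?h e)) = (\<Sum>v\<in>verts G. (x v - z v) * net_outflow G (\<lambda>e. ?f e - ?h e) v)"
    unfolding sum_net_outflow by (intro sum.cong) (auto simp: voltage_def algebra_simps)
  also have "\<dots> = 0"
  proof (rule sum.neutral, rule ballI)
    fix v assume v: "v \<in> verts G"
    have "net_outflow G (\<lambda>e. ?f e - ?h e) v = flux G mu r s x v - flux G mu 1 1 z v"
      by (simp add: flux_def net_outflow_def sum_subtractf)
    then show "(x v - z v) * net_outflow G (\<lambda>e. ?f e - ?h e) v = 0"
      using x z v by (cases "v = a \<or> v = b") (auto simp: unit_solution_def ohm.unit_solution_def)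
  qed
  finally have "(\<Sum>e\<in>arcs G. ?d e * (?g e - ?h e)) = (\<Sum>e\<in>arcs G. ?d e * (?g e - ?f e))"
    by (simp add: right_diff_distrib sum_subtractf)
  also have "\<dots> \<le> (\<Sum>e\<in>arcs G. 2 * current_error (mu e) r s)"
  proof (rule sum_mono)
    fix e assume e: "e \<in> arcs G"
    have "?d e * (?g e - ?f e) \<le> \<bar>?d e\<bar> * \<bar>?g e - ?f e\<bar>" by (metis abs_ge_self abs_mult)
    also have "\<dots> \<le> 2 * current_error (mu e) r s"
      using volt[OF e] fg[OF e] by (intro mult_mono) auto
    finally show "?d e * (?g e - ?f e) \<le> 2 * current_error (mu e) r s" .
  qed
  finally have total: "(\<Sum>e\<in>arcs G. ?d e * (?g e - ?h e)) \<le> 2 * H"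
    by (simp add: H_def sum_distrib_left)
  have fh: "\<bar>?f e - ?h e\<bar> \<le> B e" if e: "e \<in> arcs G" for e
  proof -
    have mu: "0 < mu e" using mu_pos[OF e] .
    have "0 \<le> ?d e * (?g e - ?h e)" if "e \<in> arcs G" for e
      using mono[OF that] mu_pos[OF that]
      by (meson mult_nonneg_nonneg less_imp_le zero_le_power2 order.trans)
    \<comment> \<open>All terms are nonnegative, so a single one is bounded by the total
      \<open>2 * H\<close>; the square root comes from the square in \<open>mono\<close>.\<close>
    then have "?d e * (?g e - ?h e) \<le> (\<Sum>e\<in>arcs G. ?d e * (?g e - ?h e))"
      using e by (intro member_le_sum) auto
    then have "mu e * (?g e - ?h e)\<^sup>2 \<le> 2 * H" using mono[OF e] total by linarith
    then have "(?g e - ?h e)\<^sup>2 \<le> 2 * H / mu e" using mu by (simp add: field_simps)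
    then have "\<bar>?g e - ?h e\<bar> \<le> sqrt (2 * H / mu e)" by (metis real_sqrt_abs real_sqrt_le_mono)
    then show ?thesis using fg[OF e] by (simp add: B_def)
  qed
  have "0 \<le> B e" if "e \<in> arcs G" for e using fh[OF that] by linarith
  then have part: "\<bar>\<Sum>e\<in>A. ?f e - ?h e\<bar> \<le> (\<Sum>e\<in>arcs G. B e)" if "A \<subseteq> arcs G" for A
  proof -
    have "\<bar>\<Sum>e\<in>A. ?f e - ?h e\<bar> \<le> (\<Sum>e\<in>A. \<bar>?f e - ?h e\<bar>)" by (rule sum_abs)
    also have "\<dots> \<le> (\<Sum>e\<in>A. B e)" using that fh by (intro sum_mono) auto
    also have "\<dots> \<le> (\<Sum>e\<in>arcs G. B e)"
      using that \<open>\<And>e. e \<in> arcs G \<Longrightarrow> 0 \<le> B e\<close> by (intro sum_mono2) auto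
    finally show ?thesis .
  qed
  have "conductance a b - ohm.conductance a b
      = (\<Sum>e\<in>out_arcs G a. ?f e - ?h e) - (\<Sum>e\<in>in_arcs G a. ?f e - ?h e)"
    using flux_unit_solution[OF x ab(1)] ohm.flux_unit_solution[OF z ab(1)]
    by (simp add: flux_def net_outflow_def sum_subtractf)
  also have "\<bar>\<dots>\<bar> \<le> 2 * (\<Sum>e\<in>arcs G. B e)"
    using part[of "out_arcs G a"] part[of "in_arcs G a"] by (simp add: out_arcs_def in_arcs_def)
  finally show ?thesis by (simp add: B_def)
qed

end

section \<open>The Ohm limit and its triangle inequality\<close>

context fin_digraph
begin

lemma tendsto_resistance_Ohm:
  fixes r s :: "real \<Rightarrow> real"
  assumes circuit: "\<And>t. 0 < t \<Longrightarrow> circuit G mu (r t) (s t)"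
    and mu: "\<And>e. e \<in> arcs G \<Longrightarrow> 0 < mu e"
    and s: "(s \<longlongrightarrow> 1) at_top" and r: "(r \<longlongrightarrow> 1) at_top" and ab: "a \<rightarrow>\<^sup>* b" "a \<noteq> b"
  shows "((\<lambda>t. circuit.conductance G mu (r t) (s t) a b powr (-1 / s t))
     \<longlongrightarrow> circuit.conductance G mu 1 1 a b powr (-1 / 1)) at_top"
proof -
  interpret ohm: circuit G mu 1 1 using mu by unfold_locales auto
  let ?C = "\<lambda>t. circuit.conductance G mu (r t) (s t) a b"
  have verts: "a \<in> verts G" "b \<in> verts G" using ab reachable_in_verts by auto
  define H where "H t = (\<Sum>e\<in>arcs G. current_error (mu e) (r t) (s t))" for t
  define B where "B t = 2 * (\<Sum>e\<in>arcs G. current_error (mu e) (r t) (s t) + sqrt (2 * H t / mu e))" for t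
  have err: "((\<lambda>t. current_error (mu e) (r t) (s t)) \<longlongrightarrow> 0) at_top" if e: "e \<in> arcs G" for e
  proof -
    have "((\<lambda>t. mu e powr s t) \<longlongrightarrow> mu e powr 1) at_top"
      using mu[OF e] s by (intro tendsto_powr tendsto_const) auto
    then have "((\<lambda>t. \<bar>1 / mu e powr s t - 1 / mu e\<bar> + 2 * \<bar>r t - 1\<bar> / mu e)
        \<longlongrightarrow> \<bar>1 / mu e powr 1 - 1 / mu e\<bar> + 2 * \<bar>1 - 1\<bar> / mu e) at_top"
      using mu[OF e]
      by (intro tendsto_add tendsto_divide tendsto_mult tendsto_rabs tendsto_diff tendsto_const r) auto
    then show ?thesis using mu[OF e] by (simp add: current_error_def)
  qed
  have H: "(H \<longlongrightarrow> 0) at_top"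
    unfolding H_def by (rule tendsto_null_sum) (rule err)
  have "((\<lambda>t. sqrt (2 * H t / mu e)) \<longlongrightarrow> sqrt (2 * 0 / mu e)) at_top" if "e \<in> arcs G" for e
    using mu[OF that] by (intro tendsto_real_sqrt tendsto_divide tendsto_mult tendsto_const H) auto
  then have "(B \<longlongrightarrow> 2 * (\<Sum>e\<in>arcs G. 0 + sqrt (2 * 0 / mu e))) at_top"
    unfolding B_def by (intro tendsto_mult tendsto_sum tendsto_add tendsto_const err)
  then have B: "(B \<longlongrightarrow> 0) at_top" by simp
  \<comment> \<open>The perturbation bound requires exponents of at least
    \<open>1 / 2\<close>.\<close>
  have "eventually (\<lambda>t. 1 / 2 < r t) at_top" using order_tendstoD(1)[OF r, of "1 / 2"] by simp
  with eventually_gt_at_top[of "0::real"]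
  have "eventually (\<lambda>t. norm (?C t - ohm.conductance a b) \<le> B t) at_top"
  proof eventually_elim
    case (elim t)
    interpret circuit G mu "r t" "s t" using circuit[OF elim(1)] .
    show ?case
      using conductance_diff_Ohm_le[OF verts ab(2)] elim(2) by (simp add: B_def H_def)
  qed
  then have "((\<lambda>t. ?C t - ohm.conductance a b) \<longlongrightarrow> 0) at_top"
    using B by (rule Lim_null_comparison)
  then have "(?C \<longlongrightarrow> ohm.conductance a b) at_top" by (rule LIM_zero_cancel)
  then show ?thesis
    using ohm.conductance_pos[OF ab] by (intro tendsto_powr tendsto_divide tendsto_const s) auto
qed

text \<open>With \<open>r = 1\<close> the segment estimates are linear in the voltages
  \<open>1 - x c\<close> and \<open>x c\<close>, which add up to 1.\<close>

lemma quasi_metric_Ohm: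
  assumes mu: "\<And>e. e \<in> arcs G \<Longrightarrow> 0 < mu e"
  shows "quasi_metric_on (verts G) (effective_resistance G mu 1 1)"
proof -
  interpret circuit G mu 1 1 using mu by unfold_locales auto
  let ?D = "\<lambda>a b. conductance a b powr (-1 / 1)"
  have D: "?D a b = 1 / conductance a b" if "a \<rightarrow>\<^sup>* b" "a \<noteq> b" for a b
    using conductance_pos[OF that] by (simp add: powr_minus inverse_eq_divide)
  show ?thesis
  proof (rule quasi_metric_onI)
    show "effective_resistance G mu 1 1 a b
        = (if a = b then 0 else if a \<rightarrow>\<^sup>* b then ereal (?D a b) else \<infinity>)" for a b
      by (rule effective_resistance_eq)
    show "0 < ?D a b" if "a \<rightarrow>\<^sup>* b" "a \<noteq> b" for a b
      using conductance_pos[OF that] by simp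
    show "?D a b \<le> ?D a c + ?D c b"
      if rch: "a \<rightarrow>\<^sup>* c" "c \<rightarrow>\<^sup>* b" and ne: "a \<noteq> b" "a \<noteq> c" "c \<noteq> b" for a b c
    proof -
      have ab: "a \<rightarrow>\<^sup>* b" and verts: "a \<in> verts G" "b \<in> verts G" "c \<in> verts G"
        using reachable_trans[OF rch] reachable_in_verts[OF rch(1)] reachable_in_verts[OF rch(2)] by auto
      obtain x where x: "unit_solution a b x"
        using unit_solution_exists[OF verts(1,2) ne(1)] by blast
      have "0 \<le> x c" "x c \<le> 1" using x verts by (auto simp: unit_solution_def)
      note seg = conductance_ge_segments[OF x ab verts(3) ne]
      have "1 - x c \<le> conductance a b / conductance a c"
        using seg(1) \<open>x c \<le> 1\<close> conductance_pos[OF rch(1) ne(2)] by (simp add: pos_le_divide_eq)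
      moreover have "x c \<le> conductance a b / conductance c b"
        using seg(2) \<open>0 \<le> x c\<close> conductance_pos[OF rch(2) ne(3)] by (simp add: pos_le_divide_eq)
      ultimately have "1 \<le> conductance a b * (1 / conductance a c + 1 / conductance c b)"
        by (simp add: distrib_left)
      then show ?thesis
        using conductance_pos[OF ab ne(1)] unfolding D[OF ab ne(1)] D[OF rch(1) ne(2)] D[OF rch(2) ne(3)]
        by (simp add: pos_divide_le_eq mult.commute)
    qed
  qed
qed

end

section \<open>Assembly of the four cases\<close>

theorem theorem2:
  fixes G :: "('a, 'e) pre_digraph"
    and mu lam :: "'e \<Rightarrow> real"
    and r s :: "real \<Rightarrow> real"
  assumes "fin_digraph G"
    and "\<And>e. e \<in> arcs G \<Longrightarrow> mu e > 0"
    and "\<And>e. lam e = inverse (mu e)"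
    and "\<And>t. t > 0 \<Longrightarrow> r t > 0"
    and "\<And>t. t > 0 \<Longrightarrow> s t > 0"
  shows
    "((r \<longlongrightarrow> 1) at_top \<and> (s \<longlongrightarrow> 1) at_top \<longrightarrow>
        (\<forall>a\<in>verts G. \<forall>b\<in>verts G.
          ((\<lambda>t. effective_resistance G mu (r t) (s t) a b)
             \<longlongrightarrow> effective_resistance G mu 1 1 a b) at_top) \<and>
        quasi_metric_on (verts G) (effective_resistance G mu 1 1))
   \<and> (filterlim s at_top at_top \<and> ((\<lambda>t. s t / r t) \<longlongrightarrow> 1) at_top \<longrightarrow>
        (\<forall>a\<in>verts G. \<forall>b\<in>verts G.
          ((\<lambda>t. effective_resistance G mu (r t) (s t) a b)
             \<longlongrightarrow> wf_digraph.\<mu> G mu a b) at_top) \<and>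
        quasi_metric_on (verts G) (wf_digraph.\<mu> G mu))
   \<and> (filterlim s at_top at_top \<and> filterlim (\<lambda>t. s t / r t) at_top at_top \<longrightarrow>
        (\<forall>a\<in>verts G. \<forall>b\<in>verts G.
          ((\<lambda>t. effective_resistance G mu (r t) (s t) a b)
             \<longlongrightarrow> inverse_or_convention G (max_width G lam) a b) at_top) \<and>
        quasi_ultrametric_on (verts G) (inverse_or_convention G (max_width G lam)))
   \<and> ((s \<longlongrightarrow> 1) at_top \<and> (r \<longlongrightarrow> 0) at_top \<longrightarrow>
        (\<forall>a\<in>verts G. \<forall>b\<in>verts G.
          ((\<lambda>t. effective_resistance G mu (r t) (s t) a b)
             \<longlongrightarrow> inverse_or_convention G (max_flow G lam) a b) at_top) \<and>
        quasi_ultrametric_on (verts G) (inverse_or_convention G (max_flow G lam)))"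
proof -
  interpret fin_digraph G by fact
  note mu = assms(2) and lam = assms(3)
  have circuit: "circuit G mu (r t) (s t)" if "0 < t" for t
    using mu assms(4,5)[OF that] by unfold_locales auto
  have path_pos: "p \<noteq> [] \<and> (\<forall>e\<in>set p. 0 < mu e)" if "apath a p b" "a \<noteq> b" for a b p
    using apath_arcs[OF that] mu by auto
  \<comment> \<open>What remains of each limit is the convergence of \<open>conductance\<close>
    powers for distinct \<open>a\<close> and \<open>b\<close> with \<open>b\<close>
    reachable.\<close>
  note limit = tendsto_effective_resistance[where mu = mu and r = r and s = s, OF circuit]
  show ?thesis
  proof (intro conjI impI ballI; (elim conjE)?)
    fix a b assume "(r \<longlongrightarrow> 1) at_top" "(s \<longlongrightarrow> 1) at_top"
    then have "((\<lambda>t. effective_resistance G mu (r t) (s t) a b) \<longlongrightarrow> (if a = b then 0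
        else if a \<rightarrow>\<^sup>*\<^bsub>G\<^esub> b then ereal (circuit.conductance G mu 1 1 a b powr (-1 / 1)) else \<infinity>)) at_top"
      using circuit mu by (intro limit tendsto_resistance_Ohm) auto
    moreover have "circuit G mu 1 1" using mu by unfold_locales auto
    ultimately show "((\<lambda>t. effective_resistance G mu (r t) (s t) a b)
        \<longlongrightarrow> effective_resistance G mu 1 1 a b) at_top"
      by (simp only: circuit.effective_resistance_eq)
  next
    show "quasi_metric_on (verts G) (effective_resistance G mu 1 1)"
      using mu by (rule quasi_metric_Ohm)
  next
    fix a b assume s: "filterlim s at_top at_top" and q: "((\<lambda>t. s t / r t) \<longlongrightarrow> 1) at_top"
      and a: "a \<in> verts G"
    have distance: "\<mu> mu a b = (if a = b then 0 else if a \<rightarrow>\<^sup>*\<^bsub>G\<^esub> b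
        then ereal (Min ((\<lambda>p. \<Sum>e\<leftarrow>p. mu e) ` {p. apath a p b})) else \<infinity>)"
      using mu a by (rule distance_eq)
    show "((\<lambda>t. effective_resistance G mu (r t) (s t) a b) \<longlongrightarrow> \<mu> mu a b) at_top"
      unfolding distance
      by (intro limit tendsto_resistance_path_norm circuit s tendsto_path_norm_1 q)
        (use path_pos in auto)
  next
    show "quasi_metric_on (verts G) (\<mu> mu)" using mu by (rule quasi_metric_distance)
  next
    fix a b assume s: "filterlim s at_top at_top" and q: "filterlim (\<lambda>t. s t / r t) at_top at_top"
    have "((\<lambda>t. effective_resistance G mu (r t) (s t) a b) \<longlongrightarrow> (if a = b then 0
        else if a \<rightarrow>\<^sup>*\<^bsub>G\<^esub> b then ereal (Min ((\<lambda>p. Max (mu ` set p)) ` {p. apath a p b})) else \<infinity>)) at_top"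
      by (intro limit tendsto_resistance_path_norm circuit s tendsto_path_norm_at_top q)
        (use path_pos in auto)
    then show "((\<lambda>t. effective_resistance G mu (r t) (s t) a b)
        \<longlongrightarrow> inverse_or_convention G (max_width G lam) a b) at_top"
      using max_width_inverse[of a b mu lam] mu lam by (auto simp: inverse_or_convention_def)
  next
    show "quasi_ultrametric_on (verts G) (inverse_or_convention G (max_width G lam))"
      using mu lam by (rule quasi_ultrametric_max_width)
  next
    fix a b assume "(s \<longlongrightarrow> 1) at_top" "(r \<longlongrightarrow> 0) at_top"
    then have "((\<lambda>t. effective_resistance G mu (r t) (s t) a b) \<longlongrightarrow> (if a = b then 0
        else if a \<rightarrow>\<^sup>*\<^bsub>G\<^esub> b then ereal (inverse (max_flow G lam a b)) else \<infinity>)) at_top"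
      using circuit mu lam by (intro limit tendsto_resistance_max_flow) auto
    then show "((\<lambda>t. effective_resistance G mu (r t) (s t) a b)
        \<longlongrightarrow> inverse_or_convention G (max_flow G lam) a b) at_top"
      by (auto simp: inverse_or_convention_def)
  next
    show "quasi_ultrametric_on (verts G) (inverse_or_convention G (max_flow G lam))"
      using mu lam by (rule quasi_ultrametric_max_flow)
  qed
qed

end
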